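(* Almost all cographs have a generalized $Q$-cospectral mate. That is, if $c_n$ denotes the number of isomorphism classes of cographs on $n$ vertices and $q_n$ the number of those isomorphism classes of cographs $G$ on $n$ vertices for which there exists a graph $H$ with $H\not\cong G$ such that $Q(H)$ and $Q(G)$ have the same multiset of eigenvalues and $Q(\overline{H})$ and $Q(\overline{G})$ have the same multiset of eigenvalues, then $q_n/c_n\to 1$ as $n\to\infty$.
   Context: A cograph is a finite simple graph obtained from the single-vertex graph by repeatedly applying disjoint union of two cographs and complementation (equivalently, a graph with no induced path on 4 vertices). $\overline{G}$ denotes the complement of $G$. The signless Laplacian matrix of a graph $G$ is $Q(G)=A(G)+D(G)$, where $A(G)$ is the adjacency matrix and $D(G)$ the diagonal matrix of vertex degrees. Two graphs are generalized $Q$-cospectral if their signless Laplacian matrices have the same eigenvalues (with multiplicity) and the signless Laplacian matrices of their complements have the same eigenvalues. *)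

theory Defs
  imports Complex_Main "Jordan_Normal_Form.Char_Poly"
begin

definition graph_on :: "nat \<Rightarrow> (nat \<times> nat) set \<Rightarrow> bool" where
  "graph_on n E \<longleftrightarrow> E \<subseteq> {0..<n} \<times> {0..<n} \<and> (\<forall>i j. (i,j) \<in> E \<longrightarrow> (j,i) \<in> E)
     \<and> (\<forall>i. (i,i) \<notin> E)"

definition graph_compl :: "nat \<Rightarrow> (nat \<times> nat) set \<Rightarrow> (nat \<times> nat) set" where
  "graph_compl n E = {(i,j). i < n \<and> j < n \<and> i \<noteq> j \<and> (i,j) \<notin> E}"

definition graph_iso :: "nat \<Rightarrow> (nat \<times> nat) set \<Rightarrow> (nat \<times> nat) set \<Rightarrow> bool" where
  "graph_iso n E F \<longleftrightarrow> (\<exists>p. bij_betw p {0..<n} {0..<n} \<and>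
      (\<forall>i<n. \<forall>j<n. (i,j) \<in> E \<longleftrightarrow> (p i, p j) \<in> F))"

definition iso_rel :: "nat \<Rightarrow> ((nat \<times> nat) set \<times> (nat \<times> nat) set) set" where
  "iso_rel n = {(E,F). graph_on n E \<and> graph_on n F \<and> graph_iso n E F}"

definition cograph :: "nat \<Rightarrow> (nat \<times> nat) set \<Rightarrow> bool" where
  "cograph n E \<longleftrightarrow> graph_on n E \<and>
     \<not> (\<exists>a b c d. distinct [a,b,c,d] \<and> a < n \<and> b < n \<and> c < n \<and> d < n \<and>
          (a,b) \<in> E \<and> (b,c) \<in> E \<and> (c,d) \<in> E \<and>
          (a,c) \<notin> E \<and> (b,d) \<notin> E \<and> (a,d) \<notin> E)"

definition degree_in :: "(nat \<times> nat) set \<Rightarrow> nat \<Rightarrow> nat" where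
  "degree_in E i = card {k. (i,k) \<in> E}"

definition signless_laplacian :: "nat \<Rightarrow> (nat \<times> nat) set \<Rightarrow> real mat" where
  "signless_laplacian n E = mat n n (\<lambda>(i,j).
      (if (i,j) \<in> E then 1 else 0) + (if i = j then real (degree_in E i) else 0))"

text \<open>Multiplicity of a (complex) number as an eigenvalue: its multiplicity as a root
  of the characteristic polynomial. Two matrices have the same multiset of eigenvalues
  iff all these multiplicities agree.\<close>
definition eig_mult :: "real mat \<Rightarrow> complex \<Rightarrow> nat" where
  "eig_mult A x = order x (char_poly (map_mat complex_of_real A))"

definition same_eigenvalues :: "real mat \<Rightarrow> real mat \<Rightarrow> bool" where
  "same_eigenvalues A B \<longleftrightarrow> (\<forall>x. eig_mult A x = eig_mult B x)"

definition has_gen_Q_cospectral_mate :: "nat \<Rightarrow> (nat \<times> nat) set \<Rightarrow> bool" where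
  "has_gen_Q_cospectral_mate n G \<longleftrightarrow> (\<exists>H. graph_on n H \<and> \<not> graph_iso n H G \<and>
      same_eigenvalues (signless_laplacian n H) (signless_laplacian n G) \<and>
      same_eigenvalues (signless_laplacian n (graph_compl n H))
                       (signless_laplacian n (graph_compl n G)))"

definition num_cographs :: "nat \<Rightarrow> nat" where
  "num_cographs n = card ({E. cograph n E} // iso_rel n)"

definition num_cographs_with_mate :: "nat \<Rightarrow> nat" where
  "num_cographs_with_mate n =
     card ({E. cograph n E \<and> has_gen_Q_cospectral_mate n E} // iso_rel n)"

end

theory Submission
  imports Defs "HOL-Library.FuncSet" "HOL-Library.Nat_Bijection" "HOL-Library.Disjoint_Sets"
    "HOL-Combinatorics.Permutations" "HOL-Real_Asymp.Real_Asymp"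
begin

text \<open>The claw \<open>K\<^sub>1\<^sub>,\<^sub>3\<close> and its complement \<open>K\<^sub>3 + K\<^sub>1\<close> have signless Laplacians that are conjugate
  under the reflection in \<open>w = (3, -1, -1, -1)\<close>. As \<open>w\<close> is orthogonal to the all-ones vector, the
  conjugation survives when the claw is a module of a larger graph, and it also works for the
  complements. So replacing a claw module by a triangle with an isolated vertex yields a
  generalized cospectral graph, which is not isomorphic to the original one because the number of
  vertices of one particular degree drops.

  It remains to see that almost all cotrees contain the cotree \<open>p\<close> of the claw. Let \<open>s n\<close> be the number
  of cotrees with \<open>n\<close> leaves. A tree avoiding \<open>p\<close> yields as many trees with \<open>n + 4\<close> leaves as it has
  distinct subtrees, by grafting \<open>p\<close> next to a subtree, and all of these are different. Trees with at
  most \<open>n\<^sup>1\<^sup>/\<^sup>4\<close> distinct subtrees are described by small acyclic digraphs, so they are few compared to the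
  exponentially growing \<open>s n\<close>. Finally \<open>s (n + 1) \<le> 2 log (n + 1) \<cdot> s n\<close>, so the gain \<open>n\<^sup>1\<^sup>/\<^sup>4\<close> from
  grafting beats \<open>s (n + 4) / s n\<close>.\<close>

text \<open>The obstacle is symmetry: a tree with many repeated subtrees has far fewer different
  grafts than nodes, since grafts beside equal subtrees can coincide. Hence the count of distinct
  subtrees, and the separate bound for trees that have few of them. The exponent 1/4 balances the
  two: about \<open>k\<^sup>2 log n\<close> bits describe a tree with at most \<open>k\<close>
  distinct subtrees, which must be small against \<open>n\<close>, while \<open>k\<close> must
  outgrow every power of \<open>log n\<close>; any exponent strictly between 0 and 1/2 serves. The
  bound on \<open>s (n + 1) / s n\<close> is elementary and stands in for the precise asymptotics of
  \<open>s n\<close>. As joins and unions alternate along a cotree, the label of the root is the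
  only bit that a tree leaves open, so trees and cographs agree in number up to a factor 2, which a
  share tending to 0 absorbs.\<close>

text \<open>Codes need not be canonical: each object needs some code, and each code belongs to at
  most one object. This absorbs the choice of an ordering of subtrees, of a leaf to delete, or of an
  occurrence to graft at.\<close>

lemma card_le_by_code:
  assumes "finite C" and total: "\<And>x. x \<in> S \<Longrightarrow> \<exists>c\<in>C. R x c"
    and inj: "\<And>x y c. x \<in> S \<Longrightarrow> y \<in> S \<Longrightarrow> R x c \<Longrightarrow> R y c \<Longrightarrow> x = y"
  shows "card S \<le> card C"
proof -
  obtain f where f: "\<And>x. x \<in> S \<Longrightarrow> f x \<in> C \<and> R x (f x)"
    using total by metis
  have "inj_on f S"
    by (rule inj_onI) (metis f inj)
  moreover have "f ` S \<subseteq> C"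
    using f by auto
  ultimately show ?thesis
    using \<open>finite C\<close> by (rule card_inj_on_le)
qed

subsection \<open>Trees without unary nodes\<close>

text \<open>With multisets of children, equality is isomorphism of unordered rooted trees, so
  \<open>card (subtrees t)\<close> counts shapes of subtrees and not positions.\<close>

datatype tree = Leaf | Node "tree multiset"

primrec leaves :: "tree \<Rightarrow> nat" where
  "leaves Leaf = 1"
| "leaves (Node M) = sum_mset (image_mset leaves M)"

inductive reduced :: "tree \<Rightarrow> bool" where
  reduced_Leaf: "reduced Leaf"
| reduced_Node: "2 \<le> size M \<Longrightarrow> (\<And>t. t \<in># M \<Longrightarrow> reduced t) \<Longrightarrow> reduced (Node M)"

primrec subtrees :: "tree \<Rightarrow> tree set" where
  "subtrees Leaf = {Leaf}"
| "subtrees (Node M) = insert (Node M) (\<Union> (set_mset (image_mset subtrees M)))"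

definition trees :: "nat \<Rightarrow> tree set" where
  "trees n = {t. reduced t \<and> leaves t = n}"

lemma reduced_Node_iff: "reduced (Node M) \<longleftrightarrow> 2 \<le> size M \<and> (\<forall>t\<in>#M. reduced t)"
  by (auto intro: reduced.intros elim: reduced.cases)

lemma size_le_sum_leaves:
  assumes "\<forall>t\<in>#M. 1 \<le> leaves t"
  shows "size M \<le> sum_mset (image_mset leaves M)"
  using assms by (induction M) auto

lemma leaves_pos: "reduced t \<Longrightarrow> 1 \<le> leaves t"
proof (induction rule: reduced.induct)
  case (reduced_Node M)
  then show ?case
    using size_le_sum_leaves[of M] by auto
qed auto

lemma leaves_child_less:
  assumes "reduced (Node M)" "t \<in># M"
  shows "leaves t < leaves (Node M)"
proof -
  obtain N where N: "M = add_mset t N"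
    using assms(2) by (metis mset_add)
  have "1 \<le> size N" "\<forall>u\<in>#N. reduced u"
    using assms(1) by (auto simp: reduced_Node_iff N)
  then have "1 \<le> sum_mset (image_mset leaves N)"
    using size_le_sum_leaves[of N] leaves_pos by force
  then show ?thesis by (simp add: N)
qed

lemma size_le_leaves: "reduced (Node M) \<Longrightarrow> size M \<le> leaves (Node M)"
  using size_le_sum_leaves[of M] leaves_pos by (auto simp: reduced_Node_iff)

lemma subtree_refl: "t \<in> subtrees t"
  by (cases t) auto

lemma subtrees_trans: "u \<in> subtrees t \<Longrightarrow> s \<in> subtrees u \<Longrightarrow> s \<in> subtrees t"
  by (induction t) auto

lemma finite_subtrees: "finite (subtrees t)"
  by (induction t) auto

lemma reduced_subtree: "reduced t \<Longrightarrow> s \<in> subtrees t \<Longrightarrow> reduced s"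
  by (induction t) (auto simp: reduced_Node_iff)

lemma leaves_subtree: "reduced t \<Longrightarrow> s \<in> subtrees t \<Longrightarrow> s = t \<or> leaves s < leaves t"
proof (induction t)
  case (Node M)
  from Node.prems(2) consider "s = Node M" | u where "u \<in># M" "s \<in> subtrees u" by auto
  then show ?case
  proof cases
    case 2
    then have "leaves s \<le> leaves u"
      using Node by (fastforce simp: reduced_Node_iff)
    with leaves_child_less[OF Node.prems(1) 2(1)] show ?thesis by simp
  qed simp
qed simp

text \<open>Induction on the bound: children of a reduced node have fewer leaves than the node and
  are at most as many as its leaves.\<close>

lemma finite_trees_le: "finite {t. reduced t \<and> leaves t \<le> n}"
proof (induction n)
  case 0
  have "{t. reduced t \<and> leaves t \<le> 0} = {}"
    by (auto dest: leaves_pos)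
  then show ?case by (simp only: finite.emptyI)
next
  case (Suc n)
  let ?A = "{t. reduced t \<and> leaves t \<le> n}"
  let ?L = "{xs. set xs \<subseteq> ?A \<and> length xs \<le> Suc n}"
  have "{t. reduced t \<and> leaves t \<le> Suc n} \<subseteq> insert Leaf (Node ` mset ` ?L)"
  proof
    fix t assume t: "t \<in> {t. reduced t \<and> leaves t \<le> Suc n}"
    show "t \<in> insert Leaf (Node ` mset ` ?L)"
    proof (cases t)
      case (Node M)
      obtain xs where xs: "mset xs = M" using ex_mset by blast
      have r: "reduced (Node M)" and l: "leaves (Node M) \<le> Suc n" using t Node by auto
      have "set xs \<subseteq> ?A"
        using leaves_child_less[OF r] r l unfolding xs[symmetric] reduced_Node_iff by fastforce
      moreover have "length xs \<le> Suc n"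
        using size_le_leaves[OF r] l xs by (metis le_trans size_mset)
      ultimately show ?thesis using Node xs by blast
    qed simp
  qed
  moreover have "finite ?L"
    using finite_lists_length_le[OF Suc] by simp
  ultimately show ?case
    by (meson finite.insertI finite_imageI finite_subset)
qed

lemma finite_trees: "finite (trees n)"
  by (rule finite_subset[OF _ finite_trees_le[of n]]) (auto simp: trees_def)

text \<open>The two ways to add two leaves give roots with three and with two children, hence
  disjoint images.\<close>

lemma card_trees_add_two: "2 * card (trees n) \<le> card (trees (n + 2))"
proof -
  let ?f = "\<lambda>t. Node {#t, Leaf, Leaf#}" and ?g = "\<lambda>t. Node {#t, Node {#Leaf, Leaf#}#}"
  have "inj_on ?f (trees n)" "inj_on ?g (trees n)"
    by (auto intro!: inj_onI)
  then have "card (?f ` trees n \<union> ?g ` trees n) = 2 * card (trees n)"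
    by (subst card_Un_disjoint) (auto simp: card_image finite_trees dest: arg_cong[of _ _ size])
  moreover have "?f ` trees n \<union> ?g ` trees n \<subseteq> trees (n + 2)"
    by (auto simp: trees_def reduced_Node_iff reduced_Leaf)
  ultimately show ?thesis
    by (metis card_mono finite_trees)
qed

text \<open>Growth like the powers of sqrt 2 is crude, but it only has to outweigh
  \<open>n + 1\<close> raised to the power sqrt \<open>n\<close>.\<close>

lemma card_trees_ge: "1 \<le> n \<Longrightarrow> 2 ^ ((n - 1) div 2) \<le> card (trees n)"
proof (induction n rule: nat_less_induct)
  case (1 n)
  consider "n = 1" | "n = 2" | m where "n = m + 2" "1 \<le> m"
    using 1(2) by (metis One_nat_def Suc_1 add_2_eq_Suc' le_Suc_eq le_add_diff_inverse2 not_less_eq_eq)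
  then show ?case
  proof cases
    case 1
    have "Leaf \<in> trees 1" by (simp add: trees_def reduced_Leaf)
    then have "1 \<le> card (trees 1)"
      by (metis One_nat_def Suc_leI card_gt_0_iff empty_iff finite_trees)
    then show ?thesis using 1 by simp
  next
    case 2
    have "Node {#Leaf, Leaf#} \<in> trees 2" by (simp add: trees_def reduced_Leaf reduced_Node_iff)
    then have "1 \<le> card (trees 2)"
      by (metis One_nat_def Suc_leI card_gt_0_iff empty_iff finite_trees)
    then show ?thesis using 2 by simp
  next
    case (3 m)
    then have "2 ^ ((m - 1) div 2) \<le> card (trees m)" using 1 by simp
    moreover have "(n - 1) div 2 = Suc ((m - 1) div 2)" using 3 by presburger
    ultimately show ?thesis using card_trees_add_two[of m] 3 by simp
  qed
qed

subsection \<open>Trees with few distinct subtrees\<close>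

text \<open>The adjacency matrix, with multiplicities, of the digraph obtained by sharing equal
  subtrees. Entries out of range are 0, so that codes of lists of different lengths can be
  compared.\<close>

definition dag_code :: "tree list \<Rightarrow> nat \<times> nat \<Rightarrow> nat" where
  "dag_code xs = (\<lambda>(i, j). if i < length xs \<and> j < length xs
     then (case xs ! i of Leaf \<Rightarrow> 0 | Node M \<Rightarrow> count M (xs ! j)) else 0)"

lemma dag_code_Node:
  "i < length xs \<Longrightarrow> j < length xs \<Longrightarrow> xs ! i = Node M \<Longrightarrow> dag_code xs (i, j) = count M (xs ! j)"
  by (simp add: dag_code_def)

lemma dag_code_posD:
  assumes "0 < dag_code xs (i, j)"
  shows "i < length xs" "j < length xs" "\<exists>M. xs ! i = Node M \<and> xs ! j \<in># M"
  using assms by (auto simp: dag_code_def split: if_splits tree.splits)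

lemma child_in_list:
  assumes "\<forall>t\<in>set xs. reduced t \<and> subtrees t \<subseteq> set xs"
    and "i < length xs" "xs ! i = Node M" "u \<in># M"
  obtains j where "j < length xs" "xs ! j = u" "leaves u < leaves (xs ! i)"
    "0 < dag_code xs (i, j)"
proof -
  have "reduced (Node M)" "subtrees (Node M) \<subseteq> set xs"
    using assms nth_mem by metis+
  moreover have "u \<in> subtrees (Node M)"
    using assms(4) subtree_refl by auto
  ultimately obtain j where j: "j < length xs" "xs ! j = u"
    by (meson in_set_conv_nth subsetD)
  moreover have "0 < dag_code xs (i, j)"
    using dag_code_Node[OF assms(2) j(1) assms(3)] assms(4) j(2) by simp
  ultimately show thesis
    using that leaves_child_less[OF \<open>reduced (Node M)\<close> assms(4)] assms(3) by metis
qed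

text \<open>Strong induction on the number of leaves: the children of tree \<open>i\<close> are
  smaller, so the columns with a positive entry in row \<open>i\<close> are already known to stand
  for the same trees.\<close>

lemma dag_code_inj:
  assumes xs: "\<forall>t\<in>set xs. reduced t \<and> subtrees t \<subseteq> set xs"
    and ys: "\<forall>t\<in>set ys. reduced t \<and> subtrees t \<subseteq> set ys"
    and eq: "dag_code xs = dag_code ys"
  shows "i < length xs \<Longrightarrow> i < length ys \<Longrightarrow> xs ! i = ys ! i"
proof (induction "leaves (xs ! i)" arbitrary: i rule: less_induct)
  case less
  \<comment> \<open>A positive entry of the common code forces a node at position \<open>i\<close>
    and an index \<open>j\<close> in range in the other list too.\<close>
  have row: "\<exists>N. ys ! i = Node N \<and> (\<forall>u\<in>#M. count N u = count M u)" if M: "xs ! i = Node M" for M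
  proof -
    have key: "\<exists>N. ys ! i = Node N \<and> count N u = count M u" if u: "u \<in># M" for u
    proof -
      obtain j where j: "j < length xs" "xs ! j = u" "leaves u < leaves (xs ! i)"
          "0 < dag_code xs (i, j)"
        using child_in_list[OF xs less.prems(1) M u] .
      then obtain N where N: "j < length ys" "ys ! i = Node N"
        using dag_code_posD[of ys i j] eq by metis
      then have "ys ! j = u" using less.hyps j by metis
      then show ?thesis
        using dag_code_Node[OF less.prems(1) j(1) M] dag_code_Node[OF less.prems(2) N] j(2) eq N(2)
        by metis
    qed
    \<comment> \<open>Reduced nodes have children; a node without any would have the same zero row
      as a leaf.\<close>
    have "reduced (Node M)" using xs less.prems(1) M nth_mem by metis
    then have "M \<noteq> {#}" by (auto simp: reduced_Node_iff)
    then obtain u where "u \<in># M" by blast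
    then obtain N where "ys ! i = Node N" using key by blast
    then show ?thesis using key by force
  qed
  show ?case
  proof (cases "ys ! i")
    case Leaf
    then show ?thesis using row by (cases "xs ! i") auto
  next
    case (Node N)
    \<comment> \<open>The induction measures \<open>xs\<close>, so a child of \<open>ys ! i\<close>
      is first matched with the child of \<open>xs ! i\<close> at the same position.\<close>
    have conv: "\<exists>M. xs ! i = Node M \<and> u \<in># M" if u: "u \<in># N" for u
    proof -
      obtain j where j: "j < length ys" "ys ! j = u" "0 < dag_code ys (i, j)"
        using child_in_list[OF ys less.prems(2) Node u] .
      then obtain M where M: "j < length xs" "xs ! i = Node M" "xs ! j \<in># M"
        using dag_code_posD[of xs i j] eq by metis
      have "reduced (Node M)" using xs less.prems(1) M nth_mem by metis
      then have "leaves (xs ! j) < leaves (xs ! i)"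
        using leaves_child_less M(2,3) by metis
      then have "xs ! j = u" using less.hyps[of j] j M by metis
      then show ?thesis using M by blast
    qed
    have "reduced (Node N)" using ys less.prems(2) Node nth_mem by metis
    then have "N \<noteq> {#}" by (auto simp: reduced_Node_iff)
    then obtain M where M: "xs ! i = Node M" using conv by blast
    have "\<forall>u\<in>#M. count N u = count M u" using row[OF M] Node by simp
    moreover have "\<forall>u\<in>#N. u \<in># M" using conv M by fastforce
    ultimately have "M = N"
      by (metis count_eq_zero_iff multiset_eq_iff)
    then show ?thesis using M Node by simp
  qed
qed

text \<open>A list of all subtrees is closed under children, and no child is repeated more than
  \<open>n\<close> times, so \<open>k * k\<close> numbers from 0 to \<open>n\<close> fix the
  tree.\<close>

lemma card_trees_few_subtrees:
  "card {t \<in> trees n. card (subtrees t) \<le> k} \<le> (n + 1) ^ (k * k)"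
proof -
  let ?A = "{..<k} \<times> {..<k}"
  \<comment> \<open>The tree itself stands first, so that decoding position 0 gives it back; the
    order of the other subtrees is free.\<close>
  let ?R = "\<lambda>t c. \<exists>xs. distinct xs \<and> set xs = subtrees t \<and> length xs \<le> k \<and> xs ! 0 = t
    \<and> c = restrict (dag_code xs) ?A"
  have closed: "\<forall>t\<in>set xs. reduced t \<and> subtrees t \<subseteq> set xs"
    if "set xs = subtrees t" "t \<in> trees n" for t xs
    using that reduced_subtree subtrees_trans by (fastforce simp: trees_def)
  have "card {t \<in> trees n. card (subtrees t) \<le> k} \<le> card (PiE ?A (\<lambda>_. {..n}))"
  proof (rule card_le_by_code[where R = ?R])
    show "finite (PiE ?A (\<lambda>_. {..n}))" by (intro finite_PiE) auto
  next
    fix t assume t: "t \<in> {t \<in> trees n. card (subtrees t) \<le> k}"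
    obtain ys where ys: "distinct ys" "set ys = subtrees t - {t}"
      using finite_distinct_list[of "subtrees t - {t}"] finite_subtrees by blast
    let ?xs = "t # ys"
    have xs: "distinct ?xs" "set ?xs = subtrees t" using ys subtree_refl by auto
    then have len: "length ?xs \<le> k" using t distinct_card[of ?xs] by simp
    have "dag_code ?xs (i, j) \<le> n" for i j
    proof (cases "0 < dag_code ?xs (i, j)")
      case True
      then obtain M where M: "i < length ?xs" "j < length ?xs" "?xs ! i = Node M"
        using dag_code_posD by metis
      have mem: "Node M \<in> subtrees t" using xs(2) M nth_mem by metis
      have red: "reduced t" and lt: "leaves t = n" using t by (auto simp: trees_def)
      have "count M (?xs ! j) \<le> size M" by (rule count_le_size)
      also have "\<dots> \<le> leaves (Node M)"
        by (rule size_le_leaves[OF reduced_subtree[OF red mem]])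
      also have "\<dots> \<le> n" using leaves_subtree[OF red mem] lt by auto
      finally show ?thesis using dag_code_Node[OF M] by simp
    qed simp
    then have "restrict (dag_code ?xs) ?A \<in> PiE ?A (\<lambda>_. {..n})" by auto
    then show "\<exists>c\<in>PiE ?A (\<lambda>_. {..n}). ?R t c"
      using xs len by (intro bexI[of _ "restrict (dag_code ?xs) ?A"] exI[of _ ?xs]) auto
  next
    fix t s c
    assume t: "t \<in> {t \<in> trees n. card (subtrees t) \<le> k}"
      and s: "s \<in> {t \<in> trees n. card (subtrees t) \<le> k}" and "?R t c" "?R s c"
    then obtain xs ys where xs: "set xs = subtrees t" "length xs \<le> k" "xs ! 0 = t"
        "c = restrict (dag_code xs) ?A"
      and ys: "set ys = subtrees s" "length ys \<le> k" "ys ! 0 = s"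
        "c = restrict (dag_code ys) ?A" by blast
    have "dag_code xs p = dag_code ys p" for p
    proof (cases "p \<in> ?A")
      case True
      then show ?thesis using xs(4) ys(4) by (metis restrict_apply')
    next
      case False
      then show ?thesis using xs(2) ys(2) by (cases p) (auto simp: dag_code_def)
    qed
    then have "dag_code xs = dag_code ys" by blast
    moreover have "0 < length xs" "0 < length ys" using xs(1) ys(1) subtree_refl by fastforce+
    ultimately have "xs ! 0 = ys ! 0"
      using dag_code_inj closed xs(1) ys(1) t s by blast
    then show "t = s" using xs(3) ys(3) by simp
  qed
  also have "\<dots> = (n + 1) ^ (k * k)" by (simp add: card_PiE)
  finally show ?thesis .
qed

subsection \<open>Deleting a leaf\<close>

text \<open>Descend along children of minimal size until a node with a leaf child is met, and delete
  that leaf. The child on the path then becomes the unique smallest one, so the tree is recovered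
  from the result, the depth, and one bit telling how the leaf was attached.\<close>

inductive del_leaf :: "tree \<Rightarrow> nat \<Rightarrow> bool \<Rightarrow> tree \<Rightarrow> bool" where
  del_pair: "del_leaf (Node {#t, Leaf#}) 0 False t"
| del_child: "del_leaf (Node (add_mset Leaf M)) 0 True (Node M)"
| del_deep: "del_leaf t d b t' \<Longrightarrow> \<forall>u\<in>#M. leaves t \<le> leaves u \<Longrightarrow> M \<noteq> {#} \<Longrightarrow>
    del_leaf (Node (add_mset t M)) (Suc d) b (Node (add_mset t' M))"

lemma del_leaf_leaves: "del_leaf t d b t' \<Longrightarrow> Suc (leaves t') = leaves t"
  by (induction rule: del_leaf.induct) auto

text \<open>Each step up the path adds a sibling with at least as many leaves, so the leaf count at
  least doubles and the depth is logarithmic.\<close>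

lemma del_leaf_depth: "del_leaf t d b t' \<Longrightarrow> reduced t \<Longrightarrow> 2 ^ Suc d \<le> leaves t"
proof (induction rule: del_leaf.induct)
  case (del_pair t)
  then show ?case using leaves_pos[of t] by (auto simp: reduced_Node_iff)
next
  case (del_child M)
  then show ?case using size_le_leaves[of "add_mset Leaf M"] by (simp add: reduced_Node_iff)
next
  case (del_deep t d b t' M)
  obtain u N where u: "M = add_mset u N" using del_deep.hyps(3) by (meson multiset_cases)
  have "2 ^ Suc d \<le> leaves t" using del_deep by (auto simp: reduced_Node_iff)
  moreover have "leaves t \<le> leaves u" using del_deep.hyps(2) u by simp
  ultimately show ?case by (simp add: u)
qed

lemma del_leaf_ex: "reduced t \<Longrightarrow> 2 \<le> leaves t \<Longrightarrow> \<exists>d b t'. del_leaf t d b t' \<and> reduced t'"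
proof (induction t rule: reduced.induct)
  case (reduced_Node M)
  show ?case
  proof (cases "Leaf \<in># M")
    case True
    then obtain N where N: "M = add_mset Leaf N" by (metis mset_add)
    show ?thesis
    \<comment> \<open>Deleting the leaf beside a single sibling would leave a unary node, so the
      sibling then takes the place of the node.\<close>
    proof (cases "size N = 1")
      case True
      then obtain u where "N = {#u#}" by (metis size_1_singleton_mset)
      then show ?thesis
        using N reduced_Node.hyps del_pair[of u] by (auto simp: add_mset_commute intro!: exI)
    next
      case False
      then have "reduced (Node N)" using N reduced_Node.hyps by (auto simp: reduced_Node_iff)
      then show ?thesis using N del_child by blast
    qed
  next
    case False
    obtain t where t: "t \<in># M" "\<forall>u\<in>#M. leaves t \<le> leaves u"
      using reduced_Node.hyps(1) ex_min_if_finite[of "leaves ` set_mset M"]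
      by (metis (no_types, opaque_lifting) arg_min_if_finite(1) arg_min_least finite_set_mset
          set_mset_eq_empty_iff size_empty not_numeral_le_zero)
    obtain N where N: "M = add_mset t N" using t by (metis mset_add)
    have "t \<noteq> Leaf" using t False by auto
    then obtain K where K: "t = Node K" by (cases t) auto
    have "2 \<le> leaves t"
      using size_le_leaves[of K] reduced_Node.hyps(2)[OF t(1)] K by (simp add: reduced_Node_iff)
    then obtain d b t' where d: "del_leaf t d b t'" "reduced t'"
      using reduced_Node.IH t by blast
    have "N \<noteq> {#}" using reduced_Node.hyps(1) N by auto
    then have "del_leaf (Node M) (Suc d) b (Node (add_mset t' N))"
      using del_deep[OF d(1), of N] t N by simp
    moreover have "reduced (Node (add_mset t' N))"
      using reduced_Node.hyps N d(2) by (auto simp: reduced_Node_iff)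
    ultimately show ?thesis by blast
  qed
qed simp

lemma del_leaf_inj: "del_leaf t d b r \<Longrightarrow> del_leaf s d b r \<Longrightarrow> t = s"
proof (induction arbitrary: s rule: del_leaf.induct)
  case (del_deep t d b t' M)
  from del_deep.prems obtain u u' N where s: "s = Node (add_mset u N)"
    and u: "del_leaf u d b u'" "\<forall>x\<in>#N. leaves u \<le> leaves x"
    and eq: "add_mset t' M = add_mset u' N"
    by (cases rule: del_leaf.cases) auto
  have "leaves t' < leaves x" if "x \<in># M" for x
    using del_leaf_leaves[OF del_deep.hyps(1)] del_deep.hyps(2) that by fastforce
  moreover have "leaves u' < leaves x" if "x \<in># N" for x
    using del_leaf_leaves[OF u(1)] u(2) that by fastforce
  \<comment> \<open>If they differed, each would be among the siblings of the other, and so each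
    would have strictly fewer leaves than the other.\<close>
  ultimately have "t' = u'"
    using eq by (metis add_eq_conv_ex insert_noteq_member less_asym' union_single_eq_member add_mset_remove_trivial insert_DiffM)
  then have "M = N" using eq by simp
  then show ?case using del_deep.IH u(1) \<open>t' = u'\<close> s by blast
qed (auto elim: del_leaf.cases)

lemma card_trees_Suc:
  assumes "1 \<le> n"
  shows "real (card (trees (Suc n))) \<le> 2 * log 2 (Suc n) * card (trees n)"
proof -
  define D where "D = {d. 2 ^ Suc d \<le> Suc n}"
  define m where "m = nat \<lfloor>log 2 (Suc n)\<rfloor>"
  \<comment> \<open>Depths start at 0 and \<open>Suc d\<close> is at most the logarithm, so at most
    \<open>m\<close> depths occur.\<close>
  have D: "D \<subseteq> {..<m}"
  proof
    fix d assume "d \<in> D"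
    then have "(2::real) ^ Suc d \<le> real (Suc n)"
      unfolding D_def by (metis mem_Collect_eq of_nat_le_iff of_nat_numeral of_nat_power)
    then have "real (Suc d) \<le> log 2 (Suc n)"
      by (intro le_log_of_power) auto
    then show "d \<in> {..<m}" unfolding m_def by (simp add: le_nat_floor less_eq_Suc_le del: of_nat_Suc)
  qed
  have "card (trees (Suc n)) \<le> card (trees n \<times> D \<times> (UNIV :: bool set))"
  proof (rule card_le_by_code[where R = "\<lambda>t (r, d, b). del_leaf t d b r"])
    show "finite (trees n \<times> D \<times> (UNIV :: bool set))"
      using finite_trees finite_subset[OF D] by simp
  next
    fix t assume t: "t \<in> trees (Suc n)"
    then obtain d b r where d: "del_leaf t d b r" "reduced r"
      using del_leaf_ex[of t] assms by (auto simp: trees_def)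
    have "r \<in> trees n" "d \<in> D"
      using del_leaf_leaves[OF d(1)] del_leaf_depth[OF d(1)] d(2) t
      by (auto simp: trees_def D_def)
    then show "\<exists>c\<in>trees n \<times> D \<times> UNIV. case c of (r, d, b) \<Rightarrow> del_leaf t d b r"
      using d(1) by auto
  qed (auto intro: del_leaf_inj)
  also have "\<dots> = 2 * card D * card (trees n)"
    by (simp add: card_cartesian_product)
  finally have "real (card (trees (Suc n))) \<le> 2 * real (card D) * card (trees n)"
    by (metis of_nat_le_iff of_nat_mult of_nat_numeral)
  moreover have "real (card D) \<le> real m" using card_mono[OF _ D] by simp
  moreover have "real m \<le> log 2 (Suc n)" unfolding m_def by simp
  ultimately have "2 * real (card D) * card (trees n) \<le> 2 * log 2 (Suc n) * card (trees n)"
    by (intro mult_right_mono) auto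
  with \<open>real (card (trees (Suc n))) \<le> _\<close> show ?thesis by linarith
qed

text \<open>For fixed \<open>h\<close> the factor is polylogarithmic, hence weaker than any positive
  power of \<open>n\<close>.\<close>

lemma card_trees_add:
  assumes "1 \<le> n"
  shows "real (card (trees (n + h))) \<le> (2 * log 2 (n + h)) ^ h * card (trees n)"
proof (induction h)
  case (Suc h)
  have nn: "0 \<le> log 2 (n + h)" "log 2 (n + h) \<le> log 2 (n + Suc h)" using assms by simp_all
  have "real (card (trees (n + Suc h))) \<le> 2 * log 2 (n + Suc h) * card (trees (n + h))"
    using card_trees_Suc[of "n + h"] assms by simp
  also have "\<dots> \<le> 2 * log 2 (n + Suc h) * ((2 * log 2 (n + h)) ^ h * card (trees n))"
    using Suc nn by (intro mult_left_mono) auto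
  also have "\<dots> \<le> 2 * log 2 (n + Suc h) * ((2 * log 2 (n + Suc h)) ^ h * card (trees n))"
    using nn by (intro mult_left_mono mult_right_mono power_mono) auto
  finally show ?case by (simp add: algebra_simps)
qed simp

subsection \<open>Grafting a pattern\<close>

text \<open>One occurrence of the subtree \<open>s\<close> is replaced by a node over
  \<open>s\<close> and \<open>p\<close>. The relation records \<open>s\<close> but not the
  occurrence, since only distinct subtrees are counted.\<close>

inductive graft :: "tree \<Rightarrow> tree \<Rightarrow> tree \<Rightarrow> tree \<Rightarrow> bool" for p where
  graft_here: "graft p t t (Node {#t, p#})"
| graft_there: "graft p t s t' \<Longrightarrow> graft p (Node (add_mset t M)) s (Node (add_mset t' M))"

lemma graft_ex: "s \<in> subtrees t \<Longrightarrow> \<exists>t'. graft p t s t'"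
proof (induction t)
  case (Node M)
  then consider "s = Node M" | u where "u \<in># M" "s \<in> subtrees u" by auto
  then show ?case
  proof cases
    case 2
    then obtain N where "M = add_mset u N" by (metis mset_add)
    then show ?thesis using Node.IH 2 graft_there by metis
  qed (use graft_here in blast)
qed (use graft_here in auto)

lemma graft_leaves: "graft p t s t' \<Longrightarrow> leaves t' = leaves t + leaves p"
  by (induction rule: graft.induct) auto

lemma graft_reduced: "graft p t s t' \<Longrightarrow> reduced p \<Longrightarrow> reduced t \<Longrightarrow> reduced t'"
  by (induction rule: graft.induct) (auto simp: reduced_Node_iff)

lemma graft_contains: "graft p t s t' \<Longrightarrow> p \<in> subtrees t'"
  by (induction rule: graft.induct) (auto simp: subtree_refl)

lemma graft_neq: "graft p t s t' \<Longrightarrow> reduced t \<Longrightarrow> t' \<noteq> p"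
  using graft_leaves[of p t s t'] leaves_pos[of t] by auto

text \<open>Rules out that a tree arises both by grafting at the root and by grafting below it: the
  changed child is too large to be \<open>p\<close>, so \<open>p\<close> would have to be an
  untouched child.\<close>

lemma graft_clash:
  assumes "graft p x s x'" "reduced x" "add_mset x' M = {#t, p#}" "p \<notin> subtrees (Node (add_mset x M))"
  shows False
proof -
  have "x' \<noteq> p" using graft_neq assms by blast
  moreover have "p \<in># add_mset x' M" using assms(3) by simp
  ultimately have "p \<in># M" by auto
  then show False using assms(4) subtree_refl by auto
qed

text \<open>A tree without \<open>p\<close> acquires exactly one copy of it, so the place of the
  graft can be read off from the result.\<close>

lemma graft_inj:
  assumes "graft p t1 s1 t'" "graft p t2 s2 t'" "reduced t1" "reduced t2"
    and "p \<notin> subtrees t1" "p \<notin> subtrees t2"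
  shows "t1 = t2 \<and> s1 = s2"
  using assms
proof (induction arbitrary: t2 s2 rule: graft.induct)
  case (graft_here t)
  from graft_here.prems(1) show ?case
  proof (cases rule: graft.cases)
    case graft_here
    then have "add_mset p {#t#} = add_mset p {#t2#}" by (simp add: add_mset_commute)
    then show ?thesis using graft_here by simp
  next
    case (graft_there x x' M)
    have "reduced x" using graft_here.prems(3) graft_there(1) by (simp add: reduced_Node_iff)
    moreover have "add_mset x' M = {#t, p#}" using graft_there(2) by simp
    moreover have "p \<notin> subtrees (Node (add_mset x M))"
      using graft_here.prems(5) graft_there(1) by blast
    ultimately show ?thesis using graft_clash[OF graft_there(3)] by blast
  qed
next
  case (graft_there x s x' M)
  have x: "reduced x" "p \<notin> subtrees x"
    using graft_there.prems(2,4) by (simp_all add: reduced_Node_iff)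
  from graft_there.prems(1) show ?case
  proof (cases rule: graft.cases)
    case graft_here
    then have "add_mset x' M = {#t2, p#}" by simp
    then show ?thesis using graft_clash[OF graft_there.hyps x(1)] graft_there.prems(4) by blast
  next
    case (graft_there y y' N)
    have y: "reduced y" "p \<notin> subtrees y" "\<And>u. u \<in># N \<Longrightarrow> p \<notin> subtrees u"
      using graft_there.prems(3,5) graft_there(1) by (simp_all add: reduced_Node_iff)
    \<comment> \<open>The changed child is the only one that contains \<open>p\<close>, which
      identifies it among the children.\<close>
    have "x' \<notin># N" using y(3) graft_contains[OF graft_there.hyps] by blast
    moreover have eq: "add_mset x' M = add_mset y' N" using graft_there(2) by simp
    ultimately have "x' = y'" using insert_noteq_member[of y' N x' M] by metis
    moreover from this have "M = N" using eq by simp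
    ultimately show ?thesis
      using graft_there.IH[of y s2] graft_there(1,3) x y by simp
  qed
qed

definition avoiding :: "tree \<Rightarrow> nat \<Rightarrow> tree set" where
  "avoiding p n = {t \<in> trees n. p \<notin> subtrees t}"

lemma card_avoiding_many_subtrees:
  assumes p: "reduced p" and K: "\<And>t. t \<in> S \<Longrightarrow> K \<le> card (subtrees t)" and S: "S \<subseteq> avoiding p n"
  shows "K * card S \<le> card (trees (n + leaves p))"
proof -
  have fS: "finite S" using S finite_subset finite_trees by (fastforce simp: avoiding_def)
  have "K * card S \<le> (\<Sum>t\<in>S. card (subtrees t))"
    using sum_bounded_below[of S K "\<lambda>t. card (subtrees t)"] K by (simp add: mult.commute)
  also have "\<dots> = card (Sigma S subtrees)"
    using fS finite_subtrees by (simp add: card_SigmaI)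
  also have "\<dots> \<le> card (trees (n + leaves p))"
  proof (rule card_le_by_code[where R = "\<lambda>(t, s) t'. graft p t s t'"])
    fix c assume "c \<in> Sigma S subtrees"
    then obtain t s where c: "c = (t, s)" "t \<in> S" "s \<in> subtrees t" by auto
    then obtain t' where t': "graft p t s t'" using graft_ex by blast
    moreover have "t' \<in> trees (n + leaves p)"
      using graft_leaves[OF t'] graft_reduced[OF t' p] c S by (auto simp: trees_def avoiding_def)
    ultimately show "\<exists>t'\<in>trees (n + leaves p). (\<lambda>(t, s) t'. graft p t s t') c t'"
      using c by auto
  next
    fix c1 c2 t'
    assume "c1 \<in> Sigma S subtrees" "c2 \<in> Sigma S subtrees"
      and "(\<lambda>(t, s) t'. graft p t s t') c1 t'" "(\<lambda>(t, s) t'. graft p t s t') c2 t'"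
    then show "c1 = c2"
      using graft_inj S by (fastforce simp: trees_def avoiding_def)
  qed (rule finite_trees)
  finally show ?thesis .
qed


section \<open>Asymptotics of pattern avoidance\<close>

text \<open>The first summand bounds the share of trees with at most \<open>k\<close> distinct
  subtrees, \<open>k\<close> being the fourth root of \<open>n\<close> rounded down; the second
  bounds the rest by their more than \<open>k\<close> grafts.\<close>

lemma card_avoiding_le:
  assumes p: "reduced p" and n: "1 \<le> n"
  defines "h \<equiv> leaves p"
  shows "card (avoiding p n) / card (trees n) \<le>
    (real n + 1) powr (real n powr (1/2)) / 2 powr (real n / 2 - 1)
      + (2 * log 2 (real n + real h)) ^ h / real n powr (1/4)"
proof -
  define k where "k = nat \<lfloor>real n powr (1/4)\<rfloor>"
  define few where "few = {t \<in> trees n. card (subtrees t) \<le> k}"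
  define many where "many = avoiding p n - few"
  have s0: "2 powr (real n / 2 - 1) \<le> card (trees n)"
  proof -
    \<comment> \<open>Equality for even \<open>n\<close>: this is the origin of the -1 in the
      exponent.\<close>
    have "real n / 2 - 1 \<le> real ((n - 1) div 2)" using n by linarith
    then have "2 powr (real n / 2 - 1) \<le> 2 powr real ((n - 1) div 2)" by simp
    also have "\<dots> = 2 ^ ((n - 1) div 2)" by (simp add: powr_realpow)
    also have "\<dots> \<le> card (trees n)"
      using card_trees_ge[OF n] by (metis of_nat_le_iff of_nat_numeral of_nat_power)
    finally show ?thesis .
  qed
  then have spos: "0 < real (card (trees n))"
    by (rule less_le_trans[rotated]) simp
  have k: "real k \<le> real n powr (1/4)" "real n powr (1/4) \<le> real (k + 1)"
  proof -
    have "real k = of_int \<lfloor>real n powr (1/4)\<rfloor>" unfolding k_def by simp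
    then show "real k \<le> real n powr (1/4)" "real n powr (1/4) \<le> real (k + 1)" by linarith+
  qed
  have "real (card few) \<le> (real n + 1) ^ (k * k)"
  proof -
    have "real (card few) \<le> real ((n + 1) ^ (k * k))"
      using card_trees_few_subtrees[of n k] unfolding few_def by (simp only: of_nat_le_iff)
    then show ?thesis by (simp add: add.commute)
  qed
  also have "\<dots> = (real n + 1) powr real (k * k)" by (subst powr_realpow) auto
  also have "\<dots> \<le> (real n + 1) powr (real n powr (1/2))"
  proof (rule powr_mono)
    have "real (k * k) \<le> real n powr (1/4) * real n powr (1/4)"
      using k by (simp add: mult_mono)
    also have "\<dots> = real n powr (1/2)" by (simp flip: powr_add)
    finally show "real (k * k) \<le> real n powr (1/2)" .
  qed simp
  finally have few: "real (card few) \<le> (real n + 1) powr (real n powr (1/2))" .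
  \<comment> \<open>Trees outside \<open>few\<close> have at least \<open>k + 1\<close> subtrees,
    which makes up for rounding the fourth root down.\<close>
  have "(k + 1) * card many \<le> card (trees (n + h))"
    unfolding h_def by (rule card_avoiding_many_subtrees[OF p])
      (auto simp: many_def few_def avoiding_def)
  then have "real (k + 1) * card many \<le> card (trees (n + h))"
    by (simp only: of_nat_le_iff flip: of_nat_mult)
  moreover have "real n powr (1/4) * card many \<le> real (k + 1) * card many"
    using k by (intro mult_right_mono) auto
  ultimately have "real n powr (1/4) * card many \<le> (2 * log 2 (real n + real h)) ^ h * card (trees n)"
    using card_trees_add[OF n, of h] by simp
  then have many: "card many / card (trees n) \<le> (2 * log 2 (real n + real h)) ^ h / real n powr (1/4)"
    using spos n by (simp add: field_simps)
  have "avoiding p n \<subseteq> few \<union> many" unfolding many_def by auto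
  moreover have "finite (few \<union> many)"
    by (rule finite_subset[OF _ finite_trees[of n]]) (auto simp: few_def many_def avoiding_def)
  ultimately have "card (avoiding p n) \<le> card (few \<union> many)" by (rule card_mono[rotated])
  also have "\<dots> \<le> card few + card many" by (rule card_Un_le)
  finally have "real (card (avoiding p n)) \<le> real (card few) + real (card many)" by linarith
  then have "card (avoiding p n) / card (trees n) \<le> card few / card (trees n) + card many / card (trees n)"
    using divide_right_mono[of _ _ "real (card (trees n))"] by (simp flip: add_divide_distrib)
  moreover have "card few / card (trees n) \<le> (real n + 1) powr (real n powr (1/2)) / 2 powr (real n / 2 - 1)"
    using few s0 by (intro frac_le) auto
  ultimately show ?thesis using many by linarith
qed

lemma avoiding_negligible:
  assumes "reduced p"
  shows "(\<lambda>n. card (avoiding p n) / card (trees n)) \<longlonglongrightarrow> 0"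
proof (rule tendsto_sandwich[where f = "\<lambda>_. 0"])
  define h where "h = leaves p"
  show "\<forall>\<^sub>F n in sequentially. card (avoiding p n) / card (trees n) \<le>
    (real n + 1) powr (real n powr (1/2)) / 2 powr (real n / 2 - 1)
      + (2 * log 2 (real n + real h)) ^ h / real n powr (1/4)"
    unfolding h_def by (rule eventually_sequentiallyI[of 1]) (rule card_avoiding_le[OF assms])
  have "(\<lambda>n. (real n + 1) powr (real n powr (1/2)) / 2 powr (real n / 2 - 1)) \<longlonglongrightarrow> 0"
    by real_asymp
  moreover have "(\<lambda>n. (2 * log 2 (real n + real h)) ^ h / real n powr (1/4)) \<longlonglongrightarrow> 0"
  proof -
    have h: "1 \<le> h" unfolding h_def by (rule leaves_pos[OF assms])
    \<comment> \<open>The fourth root of \<open>n\<close> is shared out among the \<open>h\<close>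
      factors: the limit is taken for a single factor and then raised to the power
      \<open>h\<close>.\<close>
    define \<epsilon> where "\<epsilon> = 1 / (4 * real h)"
    define k where "k = real h"
    have "0 < \<epsilon>" using h by (simp add: \<epsilon>_def)
    then have "(\<lambda>n. 2 * (ln (real n + k) / ln 2) / real n powr \<epsilon>) \<longlonglongrightarrow> 0"
      by real_asymp
    then have "(\<lambda>n. (2 * (ln (real n + k) / ln 2) / real n powr \<epsilon>) ^ h) \<longlonglongrightarrow> 0 ^ h"
      by (rule tendsto_power)
    moreover have "(real n powr \<epsilon>) ^ h = real n powr (1/4)" for n
    proof -
      have "(real n powr \<epsilon>) ^ h = real n powr (h * \<epsilon>)"
      proof (cases "n = 0")
        case True
        then show ?thesis using h by simp
      next
        case False
        then show ?thesis by (intro powr_power) simp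
      qed
      also have "h * \<epsilon> = 1/4" using h by (simp add: \<epsilon>_def)
      finally show ?thesis .
    qed
    moreover have "(0::real) ^ h = 0" using h by simp
    ultimately show ?thesis unfolding power_divide log_def k_def by simp
  qed
  ultimately show "(\<lambda>n. (real n + 1) powr (real n powr (1/2)) / 2 powr (real n / 2 - 1)
      + (2 * log 2 (real n + real h)) ^ h / real n powr (1/4)) \<longlonglongrightarrow> 0"
    by (rule tendsto_add_zero)
qed simp_all

subsection \<open>Cotrees\<close>

text \<open>Lists of parts, so that they line up with a list of children in which equal trees may
  occur several times. Ordered pairs of indices cover both directions of an edge.\<close>

definition separated :: "('v \<times> 'v) set \<Rightarrow> bool \<Rightarrow> 'v set list \<Rightarrow> bool" where
  "separated E b As \<longleftrightarrow> (\<forall>i<length As. \<forall>j<length As. i \<noteq> j \<longrightarrow>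
     As ! i \<inter> As ! j = {} \<and> (\<forall>x\<in>As ! i. \<forall>y\<in>As ! j. (x, y) \<in> E \<longleftrightarrow> b))"

text \<open>\<open>rep E b t V\<close>: the graph induced by \<open>E\<close> on \<open>V\<close> has cotree \<open>t\<close>, where the root is a join
  if \<open>b\<close> and a disjoint union otherwise, and the two kinds alternate along the tree. The root of a
  single leaf may be given either label.\<close>

inductive rep :: "('v \<times> 'v) set \<Rightarrow> bool \<Rightarrow> tree \<Rightarrow> 'v set \<Rightarrow> bool" for E where
  rep_Leaf: "rep E b Leaf {v}"
| rep_Node: "2 \<le> length ts \<Longrightarrow> length As = length ts \<Longrightarrow>
    (\<And>i. i < length ts \<Longrightarrow> rep E (\<not> b) (ts ! i) (As ! i)) \<Longrightarrow> separated E b As \<Longrightarrow>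
    rep E b (Node (mset ts)) (\<Union> (set As))"

lemma separatedD:
  assumes "separated E b As" "i < length As" "j < length As" "i \<noteq> j"
  shows "As ! i \<inter> As ! j = {}" and "x \<in> As ! i \<Longrightarrow> y \<in> As ! j \<Longrightarrow> (x, y) \<in> E \<longleftrightarrow> b"
  using assms unfolding separated_def by blast+

lemma rep_nonempty: "rep E b t V \<Longrightarrow> V \<noteq> {}"
proof (induction rule: rep.induct)
  case (rep_Node ts As b)
  then have "0 < length ts" by linarith
  then have "As ! 0 \<noteq> {}" "As ! 0 \<in> set As" using rep_Node by auto
  then show ?case by blast
qed simp

lemma rep_finite: "rep E b t V \<Longrightarrow> finite V"
proof (induction rule: rep.induct)
  case (rep_Node ts As b)
  then have "\<forall>A\<in>set As. finite A" by (metis in_set_conv_nth)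
  then show ?case by blast
qed simp

lemma rep_reduced: "rep E b t V \<Longrightarrow> reduced t"
proof (induction rule: rep.induct)
  case (rep_Node ts As b)
  then show ?case by (auto simp: reduced_Node_iff in_set_conv_nth)
qed (rule reduced_Leaf)

lemma Union_set_nth: "\<Union> (set As) = (\<Union>i<length As. As ! i)"
  by (auto simp: set_conv_nth)

lemma rep_card: "rep E b t V \<Longrightarrow> leaves t = card V"
proof (induction rule: rep.induct)
  case (rep_Node ts As b)
  have "card (\<Union> (set As)) = (\<Sum>i<length As. card (As ! i))"
    unfolding Union_set_nth
  proof (rule card_UN_disjoint)
    show "\<forall>i\<in>{..<length As}. finite (As ! i)"
      using rep_Node.hyps(2,3) rep_finite by (metis lessThan_iff)
    show "\<forall>i\<in>{..<length As}. \<forall>j\<in>{..<length As}. i \<noteq> j \<longrightarrow> As ! i \<inter> As ! j = {}"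
      using separatedD(1)[OF rep_Node.hyps(4)] by simp
  qed simp
  also have "\<dots> = (\<Sum>i<length ts. leaves (ts ! i))"
    using rep_Node by simp
  also have "\<dots> = leaves (Node (mset ts))"
    by (simp add: sum_mset_sum_list sum_list_sum_nth atLeast0LessThan flip: mset_map)
  finally show ?case by simp
qed simp

lemma rep_transfer:
  assumes "rep E b t V" "inj_on p V" "\<And>x y. x \<in> V \<Longrightarrow> y \<in> V \<Longrightarrow> (x, y) \<in> E \<longleftrightarrow> (p x, p y) \<in> F"
  shows "rep F b t (p ` V)"
  using assms
proof (induction rule: rep.induct)
  case (rep_Leaf b v)
  show ?case by (simp add: rep.rep_Leaf)
next
  case (rep_Node ts As b)
  have sub: "As ! i \<subseteq> \<Union> (set As)" if "i < length ts" for i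
    using that rep_Node.hyps(2) nth_mem by (metis Union_upper)
  have "rep F b (Node (mset ts)) (\<Union> (set (map ((`) p) As)))"
  proof (rule rep.rep_Node)
    show "length (map ((`) p) As) = length ts" "2 \<le> length ts" using rep_Node by simp_all
    show "rep F (\<not> b) (ts ! i) (map ((`) p) As ! i)" if i: "i < length ts" for i
    proof -
      have "rep F (\<not> b) (ts ! i) (p ` (As ! i))"
      proof (rule rep_Node.IH[OF i])
        show "inj_on p (As ! i)" using rep_Node.prems(1) sub[OF i] by (rule inj_on_subset)
        show "(x, y) \<in> E \<longleftrightarrow> (p x, p y) \<in> F" if "x \<in> As ! i" "y \<in> As ! i" for x y
          using that sub[OF i] by (intro rep_Node.prems(2)) auto
      qed
      then show ?thesis using i rep_Node.hyps(2) by simp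
    qed
    show "separated F b (map ((`) p) As)"
      unfolding separated_def
    proof (intro allI impI conjI)
      fix i j assume "i < length (map ((`) p) As)" "j < length (map ((`) p) As)" "i \<noteq> j"
      then have ij: "i < length As" "j < length As" "i \<noteq> j" by auto
      note D = separatedD[OF rep_Node.hyps(4) ij]
      have S: "As ! i \<subseteq> \<Union> (set As)" "As ! j \<subseteq> \<Union> (set As)" using sub ij rep_Node.hyps(2) by auto
      show "map ((`) p) As ! i \<inter> map ((`) p) As ! j = {}"
        using D(1) S rep_Node.prems(1) ij by (simp flip: inj_on_image_Int)
      show "\<forall>x\<in>map ((`) p) As ! i. \<forall>y\<in>map ((`) p) As ! j. (x, y) \<in> F \<longleftrightarrow> b"
      proof -
        have "(p x, p y) \<in> F \<longleftrightarrow> b" if "x \<in> As ! i" "y \<in> As ! j" for x y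
          using D(2)[OF that] rep_Node.prems(2)[of x y] S that by blast
        then show ?thesis using ij by simp
      qed
    qed
  qed
  moreover have "\<Union> (set (map ((`) p) As)) = p ` \<Union> (set As)" by auto
  ultimately show ?case by simp
qed

text \<open>Joins are connected, and disjoint unions are co-connected.\<close>

lemma rep_cut:
  assumes "rep E b t A" "X \<noteq> {}" "X \<subset> A"
  shows "\<exists>x\<in>X. \<exists>y\<in>A - X. (x, y) \<in> E \<longleftrightarrow> b"
  using assms(1)
proof cases
  case (rep_Leaf v)
  then show ?thesis using assms by auto
next
  case (rep_Node ts As)
  have part: "\<exists>i<length As. v \<in> As ! i" if "v \<in> A" for v
    using that rep_Node(2) by (metis UnionE in_set_conv_nth)
  obtain x where "x \<in> X" using assms(2) by blast
  then obtain i where x: "x \<in> X" "x \<in> As ! i" "i < length As"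
    using part assms(3) by blast
  obtain y where "y \<in> A - X" using assms(3) by blast
  then obtain j where y: "y \<in> A - X" "y \<in> As ! j" "j < length As"
    using part by blast
  show ?thesis
  proof (cases "i = j")
    case False
    then show ?thesis using separatedD(2)[OF rep_Node(6)] x y by blast
  next
    case True
    obtain k where k: "k < length As" "k \<noteq> i"
    proof (cases "i = 0")
      case True
      then show ?thesis using that[of 1] rep_Node(3,4) by simp
    next
      case False
      then show ?thesis using that[of 0] x(3) by fastforce
    qed
    obtain z where z: "z \<in> As ! k" using rep_nonempty[OF rep_Node(5)] k rep_Node(4) by force
    then have "z \<in> A" using rep_Node(2) k by auto
    then show ?thesis
      using separatedD(2)[OF rep_Node(6)] x y z k True by (metis Diff_iff)
  qed
qed

section \<open>Uniqueness of the cotree, and of the graph up to isomorphism\<close>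

text \<open>By \<open>rep_cut\<close>, cutting a set with root label \<open>\<not> b\<close> leaves
  a pair of kind \<open>\<not> b\<close> across the cut, whereas all pairs between different parts
  are of kind \<open>b\<close>.\<close>

lemma rep_within_part:
  assumes "rep E (\<not> b) t A" "A \<subseteq> \<Union> (set Bs)" "separated E b Bs"
  shows "\<exists>B\<in>set Bs. A \<subseteq> B"
proof -
  obtain x where "x \<in> A" using rep_nonempty[OF assms(1)] by blast
  then obtain i where i: "i < length Bs" "x \<in> Bs ! i"
    using assms(2) by (metis UnionE in_set_conv_nth subsetD)
  have "A \<subseteq> Bs ! i"
  proof (rule ccontr)
    assume "\<not> A \<subseteq> Bs ! i"
    then have "A \<inter> Bs ! i \<subset> A" "A \<inter> Bs ! i \<noteq> {}" using \<open>x \<in> A\<close> i by auto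
    then obtain u v where uv: "u \<in> A \<inter> Bs ! i" "v \<in> A - A \<inter> Bs ! i" "(u, v) \<in> E \<longleftrightarrow> \<not> b"
      using rep_cut[OF assms(1)] by meson
    then obtain j where "j < length Bs" "v \<in> Bs ! j"
      using assms(2) by (metis DiffD1 UnionE in_set_conv_nth subsetD)
    then show False using separatedD(2)[OF assms(3) i(1)] uv by blast
  qed
  then show ?thesis using i by auto
qed

lemma separated_eq_part:
  assumes "separated E b As" "A \<in> set As" "B \<in> set As" "A \<subseteq> B" "A \<noteq> {}"
  shows "A = B"
  using assms separatedD(1)[OF assms(1)]
  by (metis Int_absorb2 in_set_conv_nth)

text \<open>Each part lies in a part of the other list and conversely; disjointness collapses the
  chain \<open>A \<subseteq> B \<subseteq> A'\<close>.\<close>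

lemma separated_subset:
  assumes "separated E b As" "separated E b Bs" "\<Union> (set As) = \<Union> (set Bs)"
    and "\<forall>A\<in>set As. \<exists>t. rep E (\<not> b) t A" "\<forall>B\<in>set Bs. \<exists>t. rep E (\<not> b) t B"
  shows "set As \<subseteq> set Bs"
proof
  fix A assume A: "A \<in> set As"
  then obtain B where B: "B \<in> set Bs" "A \<subseteq> B"
    using rep_within_part[of E b _ A Bs] assms by (metis Union_upper)
  then obtain A' where A': "A' \<in> set As" "B \<subseteq> A'"
    using rep_within_part[of E b _ B As] assms by (metis Union_upper)
  then have "A = A'"
    using separated_eq_part[OF assms(1) A A'(1)] B rep_nonempty assms(4) A by (metis subset_trans)
  then show "A \<in> set Bs" using A' B by auto
qed

lemma separated_distinct:
  assumes "separated E b As" "{} \<notin> set As"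
  shows "distinct As"
  using assms separatedD(1)[OF assms(1)] unfolding distinct_conv_nth by (metis Int_absorb nth_mem)

text \<open>The parts at the root are the components of the graph or of its complement, hence
  determined by \<open>E\<close>, \<open>b\<close> and the vertex set; induction handles the
  children.\<close>

lemma rep_unique:
  assumes "rep E b t V" "rep E b s V"
  shows "s = t"
  using assms
proof (induction arbitrary: s rule: rep.induct)
  case (rep_Leaf b v)
  then have "leaves s = 1" "reduced s" using rep_card rep_reduced by fastforce+
  then show ?case using size_le_leaves by (cases s) (fastforce simp: reduced_Node_iff)+
next
  case (rep_Node ts As b)
  have "rep E b (Node (mset ts)) (\<Union> (set As))" using rep_Node by (intro rep.rep_Node) auto
  then have "2 \<le> card (\<Union> (set As))"
    using size_le_leaves[of "mset ts"] rep_card rep_reduced rep_Node.hyps(1)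
    by (metis le_trans size_mset)
  then have "s \<noteq> Leaf" using rep_card[OF rep_Node.prems] by auto
  with rep_Node.prems obtain us Bs where us: "s = Node (mset us)" "\<Union> (set As) = \<Union> (set Bs)"
      "length Bs = length us" "\<And>i. i < length us \<Longrightarrow> rep E (\<not> b) (us ! i) (Bs ! i)" "separated E b Bs"
    by (cases rule: rep.cases) auto
  have rA: "\<forall>A\<in>set As. \<exists>t. rep E (\<not> b) t A" using rep_Node by (metis in_set_conv_nth)
  have rB: "\<forall>B\<in>set Bs. \<exists>t. rep E (\<not> b) t B" using us by (metis in_set_conv_nth)
  have eq: "set As = set Bs"
    using separated_subset[OF rep_Node.hyps(4) us(5) us(2) rA rB]
      separated_subset[OF us(5) rep_Node.hyps(4) us(2)[symmetric] rB rA] by blast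
  have "distinct As" "distinct Bs"
    using separated_distinct[OF rep_Node.hyps(4)] separated_distinct[OF us(5)] rA rB rep_nonempty
    by metis+
  then have ms: "mset As = mset Bs" using eq set_eq_iff_mset_eq_distinct by blast
  \<comment> \<open>Each part has only one cotree by induction, so both lists of children are images
    of the same multiset of parts under \<open>g\<close>.\<close>
  define g where "g = (\<lambda>A. THE t. rep E (\<not> b) t A)"
  have g: "g (As ! i) = ts ! i" if "i < length ts" for i
    unfolding g_def using rep_Node.IH rep_Node.hyps that by (intro the_equality) auto
  then have "ts = map g As" using rep_Node.hyps(2) by (intro nth_equalityI) auto
  moreover have "us = map g Bs"
  proof (rule nth_equalityI)
    fix j assume j: "j < length us"
    then obtain i where i: "i < length ts" "Bs ! j = As ! i"
      using eq us(3) rep_Node.hyps(2) by (metis in_set_conv_nth)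
    then have "us ! j = ts ! i" using rep_Node.IH[OF i(1)] us(4)[OF j] by simp
    then show "us ! j = map g Bs ! j" using g i j us(3) by simp
  qed (use us in simp)
  ultimately show ?case using us(1) ms by simp
qed

text \<open>Equal multisets of children give a matching \<open>\<sigma>\<close> of the parts.
  Isomorphisms of matched parts glue together, since pairs between different parts depend only on
  \<open>b\<close>.\<close>

lemma rep_iso:
  assumes "rep E b t V" "rep F b t W" "\<And>x. (x, x) \<notin> E" "\<And>x. (x, x) \<notin> F"
  shows "\<exists>p. bij_betw p V W \<and> (\<forall>x\<in>V. \<forall>y\<in>V. (x, y) \<in> E \<longleftrightarrow> (p x, p y) \<in> F)"
  using assms(1,2)
proof (induction arbitrary: W rule: rep.induct)
  case (rep_Leaf b v)
  then obtain w where "W = {w}" by (auto elim: rep.cases)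
  then show ?case using assms(3,4) by (intro exI[of _ "\<lambda>_. w"]) (auto simp: bij_betw_def)
next
  case (rep_Node ts As b)
  from rep_Node.prems obtain us Bs where us: "mset us = mset ts" "W = \<Union> (set Bs)"
      "length Bs = length us" "\<And>i. i < length us \<Longrightarrow> rep F (\<not> b) (us ! i) (Bs ! i)" "separated F b Bs"
    by (cases rule: rep.cases) auto
  define n where "n = length ts"
  have len: "length us = n" "length As = n" "length Bs = n"
    using us(1,3) rep_Node.hyps(2) unfolding n_def by (metis size_mset)+
  obtain \<sigma> where \<sigma>: "\<sigma> permutes {..<n}" "permute_list \<sigma> us = ts"
    using mset_eq_permutation[of ts us] us(1) len by metis
  have \<sigma>n: "\<sigma> i < n" if "i < n" for i using permutes_in_image[OF \<sigma>(1)] that by blast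
  have "\<exists>p. bij_betw p (As ! i) (Bs ! \<sigma> i) \<and>
      (\<forall>x\<in>As ! i. \<forall>y\<in>As ! i. (x, y) \<in> E \<longleftrightarrow> (p x, p y) \<in> F)" if "i < n" for i
  proof -
    have "us ! \<sigma> i = ts ! i" using \<sigma> len that permute_list_nth by metis
    then show ?thesis using rep_Node.IH[of i] us(4)[of "\<sigma> i"] \<sigma>n[OF that] len that n_def by simp
  qed
  then obtain p where p: "\<And>i. i < n \<Longrightarrow> bij_betw (p i) (As ! i) (Bs ! \<sigma> i)"
      "\<And>i x y. i < n \<Longrightarrow> x \<in> As ! i \<Longrightarrow> y \<in> As ! i \<Longrightarrow> (x, y) \<in> E \<longleftrightarrow> (p i x, p i y) \<in> F"
    by metis
  define q where "q x = p (THE i. i < n \<and> x \<in> As ! i) x" for x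
  have q: "q x = p i x" if "i < n" "x \<in> As ! i" for i x
  proof -
    have "(THE i. i < n \<and> x \<in> As ! i) = i"
      using that separatedD(1)[OF rep_Node.hyps(4), of _ i] len by (intro the_equality) auto
    then show ?thesis by (simp add: q_def)
  qed
  have bq: "bij_betw q (As ! i) (Bs ! \<sigma> i)" if "i < n" for i
    using p(1)[OF that] q[OF that] by (metis bij_betw_cong)
  have "bij_betw q (\<Union>i<n. As ! i) (\<Union>i<n. Bs ! \<sigma> i)"
  proof (rule bij_betw_UNION_disjoint)
    have "Bs ! \<sigma> i \<inter> Bs ! \<sigma> j = {}" if "i < n" "j < n" "i \<noteq> j" for i j
      using separatedD(1)[OF us(5), of "\<sigma> i" "\<sigma> j"] that \<sigma>n len permutes_inj[OF \<sigma>(1)]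
      by (simp add: inj_eq)
    then show "disjoint_family_on (\<lambda>i. Bs ! \<sigma> i) {..<n}"
      by (auto simp: disjoint_family_on_def)
  qed (use bq in auto)
  moreover have "(\<Union>i<n. Bs ! \<sigma> i) = \<Union> (set Bs)"
  proof -
    have "(\<Union>i<n. Bs ! \<sigma> i) = (\<Union>j\<in>\<sigma> ` {..<n}. Bs ! j)" by simp
    then show ?thesis using permutes_image[OF \<sigma>(1)] Union_set_nth[of Bs] len by simp
  qed
  ultimately have "bij_betw q (\<Union> (set As)) W" using us(2) Union_set_nth[of As] len by simp
  moreover have "(x, y) \<in> E \<longleftrightarrow> (q x, q y) \<in> F" if xy: "x \<in> \<Union> (set As)" "y \<in> \<Union> (set As)" for x y
  proof -
    obtain i j where ij: "i < n" "x \<in> As ! i" "j < n" "y \<in> As ! j"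
      using xy len by (metis UnionE in_set_conv_nth)
    show ?thesis
    proof (cases "i = j")
      case True
      then show ?thesis using p(2) q ij by metis
    next
      case False
      then have "\<sigma> i \<noteq> \<sigma> j" using permutes_inj[OF \<sigma>(1)] by (simp add: inj_eq)
      moreover have "q x \<in> Bs ! \<sigma> i" "q y \<in> Bs ! \<sigma> j" using bq ij by (meson bij_betwE)+
      moreover have "\<sigma> i < length Bs" "\<sigma> j < length Bs" using \<sigma>n ij len by simp_all
      ultimately have "(q x, q y) \<in> F \<longleftrightarrow> b" using separatedD(2)[OF us(5)] by metis
      moreover have "(x, y) \<in> E \<longleftrightarrow> b"
        using separatedD(2)[OF rep_Node.hyps(4) _ _ False ij(2,4)] ij len by simp
      ultimately show ?thesis by simp
    qed
  qed
  ultimately show ?case by blast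
qed

subsection \<open>Existence of cotrees\<close>

text \<open>Pairing each vertex with the index of its child makes the child graphs disjoint within
  \<open>nat\<close>, so the vertex type stays fixed through the induction.\<close>

lemma rep_exists:
  assumes "reduced t"
  shows "\<exists>(E :: (nat \<times> nat) set) V. sym E \<and> irrefl E \<and> rep E b t V"
  using assms
proof (induction arbitrary: b rule: reduced.induct)
  case reduced_Leaf
  have "rep {} b Leaf {0::nat}" by (rule rep_Leaf)
  moreover have "sym ({} :: (nat \<times> nat) set)" "irrefl ({} :: (nat \<times> nat) set)"
    by (auto simp: sym_def irrefl_def)
  ultimately show ?case by blast
next
  case (reduced_Node M)
  obtain ts where ts: "mset ts = M" using ex_mset by blast
  define n where "n = length ts"
  have "\<exists>(E :: (nat \<times> nat) set) V. sym E \<and> irrefl E \<and> rep E (\<not> b) (ts ! i) V" if "i < n" for i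
    using reduced_Node.IH[of "ts ! i"] that ts nth_mem_mset n_def by blast
  then obtain F :: "nat \<Rightarrow> (nat \<times> nat) set" and W where
    F: "\<And>i. i < n \<Longrightarrow> sym (F i) \<and> irrefl (F i) \<and> rep (F i) (\<not> b) (ts ! i) (W i)"
    by metis
  define E where "E = {(x, y). \<exists>i u j v. x = prod_encode (i, u) \<and> y = prod_encode (j, v) \<and>
    i < n \<and> j < n \<and> (if i = j then (u, v) \<in> F i else b)}"
  have E: "(prod_encode (i, u), prod_encode (j, v)) \<in> E \<longleftrightarrow>
      i < n \<and> j < n \<and> (if i = j then (u, v) \<in> F i else b)" for i u j v
    by (auto simp: E_def)
  have "sym E"
  proof (rule symI)
    fix x y assume "(x, y) \<in> E"
    then obtain i u j v where "x = prod_encode (i, u)" "y = prod_encode (j, v)"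
      "i < n" "j < n" "if i = j then (u, v) \<in> F i else b" by (auto simp: E_def)
    then show "(y, x) \<in> E" using F[of i] by (auto simp: E split: if_splits dest: symD)
  qed
  moreover have "irrefl E"
  proof (rule irreflI)
    fix x
    obtain i u where "x = prod_encode (i, u)" by (metis prod_decode_inverse surj_pair)
    then show "(x, x) \<notin> E" using F[of i] by (auto simp: E irrefl_def)
  qed
  moreover have "\<exists>V. rep E b (Node M) V"
  proof -
    define As where "As = map (\<lambda>i. (\<lambda>v. prod_encode (i, v)) ` W i) [0..<n]"
    have len: "length As = n" by (simp add: As_def)
    have A: "As ! i = (\<lambda>v. prod_encode (i, v)) ` W i" if "i < n" for i
      using that by (simp add: As_def)
    have "rep E b (Node (mset ts)) (\<Union> (set As))"
    proof (rule rep_Node)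
      show "2 \<le> length ts" using reduced_Node.hyps(1) ts by auto
      show "length As = length ts" using len n_def by simp
      show "rep E (\<not> b) (ts ! i) (As ! i)" if "i < length ts" for i
      proof -
        have i: "i < n" using that n_def by simp
        have "rep E (\<not> b) (ts ! i) ((\<lambda>v. prod_encode (i, v)) ` W i)"
        proof (rule rep_transfer)
          show "rep (F i) (\<not> b) (ts ! i) (W i)" using F[OF i] by simp
        qed (use i in \<open>auto simp: inj_on_def E\<close>)
        then show ?thesis using A[OF i] by simp
      qed
      show "separated E b As"
        unfolding separated_def using A len by (auto simp: E)
    qed
    then show ?thesis using ts by auto
  qed
  ultimately show ?case by blast
qed

text \<open>A path on four vertices and its complement are both connected, so such a path cannot
  meet two of the parts of a cotree node.\<close>

lemma rep_P4_free:
  assumes "rep E b t V" "sym E"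
    and "a \<in> V" "c \<in> V" "d \<in> V" "e \<in> V"
    and "(a, c) \<in> E" "(c, d) \<in> E" "(d, e) \<in> E" "(a, d) \<notin> E" "(c, e) \<notin> E" "(a, e) \<notin> E"
    and "distinct [a, c, d, e]"
  shows False
  using assms
proof (induction rule: rep.induct)
  case (rep_Node ts As b)
  have part: "\<exists>i<length As. v \<in> As ! i" if "v \<in> \<Union> (set As)" for v
    using that by (metis UnionE in_set_conv_nth)
  obtain i j k l where ijkl: "i < length As" "a \<in> As ! i" "j < length As" "c \<in> As ! j"
      "k < length As" "d \<in> As ! k" "l < length As" "e \<in> As ! l"
    using part rep_Node.prems(2-5) by metis
  have same: "m = n" if "m < length As" "n < length As" "x \<in> As ! m" "y \<in> As ! n"
    "(x, y) \<in> E \<longleftrightarrow> \<not> b" for m n x y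
    using separatedD(2)[OF rep_Node.hyps(4) that(1,2) _ that(3,4)] that(5) by blast
  have "i = j \<and> j = k \<and> k = l"
  proof (cases b)
    case True
    have "i = k" by (rule same[of i k a d]) (use True ijkl rep_Node.prems(9) in simp_all)
    moreover have "j = l" by (rule same[of j l c e]) (use True ijkl rep_Node.prems(10) in simp_all)
    moreover have "i = l" by (rule same[of i l a e]) (use True ijkl rep_Node.prems(11) in simp_all)
    ultimately show ?thesis by simp
  next
    case False
    have "i = j" by (rule same[of i j a c]) (use False ijkl rep_Node.prems(6) in simp_all)
    moreover have "j = k" by (rule same[of j k c d]) (use False ijkl rep_Node.prems(7) in simp_all)
    moreover have "k = l" by (rule same[of k l d e]) (use False ijkl rep_Node.prems(8) in simp_all)
    ultimately show ?thesis by simp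
  qed
  then show False
    using rep_Node.IH[of i] ijkl rep_Node.prems rep_Node.hyps(2) by simp
qed auto

text \<open>Any cotree can be read as a list of parts below a root labelled \<open>b\<close>: as a
  single part if it admits the root label \<open>\<not> b\<close>, and else as its children. This
  keeps the labels alternating when cotrees are merged.\<close>

lemma rep_parts:
  assumes "rep E b' t V"
  shows "\<exists>ts As. 1 \<le> length ts \<and> length As = length ts \<and>
    (\<forall>i<length ts. rep E (\<not> b) (ts ! i) (As ! i)) \<and> separated E b As \<and> \<Union> (set As) = V"
proof (cases "rep E (\<not> b) t V")
  case True
  then show ?thesis by (intro exI[of _ "[t]"] exI[of _ "[V]"]) (auto simp: separated_def)
next
  case False
  then have "b' = b" using assms by (cases "b' = b") auto
  with assms have "rep E b t V" by simp
  then show ?thesis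
  proof (cases rule: rep.cases)
    case (rep_Leaf v)
    have "rep E (\<not> b) t V" unfolding rep_Leaf by (rule rep.rep_Leaf)
    then show ?thesis using False by simp
  next
    case (rep_Node ts As)
    show ?thesis
      by (intro exI[of _ ts] exI[of _ As] conjI) (use rep_Node in simp_all)
  qed
qed

text \<open>Concatenating the lists of parts flattens nested nodes with equal labels; each side
  contributes a part, so no unary node arises.\<close>

lemma rep_Un:
  assumes "rep E b1 t1 X" "rep E b2 t2 Y" "X \<inter> Y = {}" "sym E"
    and cross: "\<And>x y. x \<in> X \<Longrightarrow> y \<in> Y \<Longrightarrow> (x, y) \<in> E \<longleftrightarrow> b"
  shows "\<exists>t. rep E b t (X \<union> Y)"
proof -
  obtain ts As where A: "1 \<le> length ts" "length As = length ts"
      "\<And>i. i < length ts \<Longrightarrow> rep E (\<not> b) (ts ! i) (As ! i)" "separated E b As" "\<Union> (set As) = X"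
    using rep_parts[OF assms(1), of b] by blast
  obtain us Bs where B: "1 \<le> length us" "length Bs = length us"
      "\<And>i. i < length us \<Longrightarrow> rep E (\<not> b) (us ! i) (Bs ! i)" "separated E b Bs" "\<Union> (set Bs) = Y"
    using rep_parts[OF assms(2), of b] by blast
  have cr: "As ! i \<inter> Bs ! j = {} \<and> Bs ! j \<inter> As ! i = {} \<and>
      (\<forall>x\<in>As ! i. \<forall>y\<in>Bs ! j. ((x, y) \<in> E \<longleftrightarrow> b) \<and> ((y, x) \<in> E \<longleftrightarrow> b))"
    if "i < length As" "j < length Bs" for i j
  proof -
    have "As ! i \<subseteq> X" "Bs ! j \<subseteq> Y" using A(5) B(5) that nth_mem by blast+
    then show ?thesis using assms(3,4) cross by (blast dest: symD)
  qed
  have "rep E b (Node (mset (ts @ us))) (\<Union> (set (As @ Bs)))"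
  proof (rule rep_Node)
    show "2 \<le> length (ts @ us)" "length (As @ Bs) = length (ts @ us)" using A B by auto
    show "rep E (\<not> b) ((ts @ us) ! i) ((As @ Bs) ! i)" if "i < length (ts @ us)" for i
      using that A(2,3) B(2,3) by (simp add: nth_append)
    show "separated E b (As @ Bs)"
      unfolding separated_def
    proof (intro allI impI)
      fix i j assume "i < length (As @ Bs)" "j < length (As @ Bs)" "i \<noteq> j"
      then have ij: "i < length As + length Bs" "j < length As + length Bs" "i \<noteq> j" by simp_all
      show "(As @ Bs) ! i \<inter> (As @ Bs) ! j = {} \<and>
          (\<forall>x\<in>(As @ Bs) ! i. \<forall>y\<in>(As @ Bs) ! j. (x, y) \<in> E \<longleftrightarrow> b)"
      proof (cases "i < length As"; cases "j < length As")
        assume "i < length As" "j < length As"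
        then show ?thesis using A(4) ij(3) unfolding separated_def by (simp add: nth_append)
      next
        assume "i < length As" "\<not> j < length As"
        then show ?thesis using cr[of i "j - length As"] ij by (simp add: nth_append)
      next
        assume "\<not> i < length As" "j < length As"
        then show ?thesis using cr[of j "i - length As"] ij by (simp add: nth_append)
      next
        assume "\<not> i < length As" "\<not> j < length As"
        moreover from this have "i - length As < length Bs" "j - length As < length Bs"
          "i - length As \<noteq> j - length As" using ij by linarith+
        ultimately show ?thesis using B(4) unfolding separated_def by (simp add: nth_append)
      qed
    qed
  qed
  moreover have "\<Union> (set (As @ Bs)) = X \<union> Y" using A(5) B(5) by auto
  ultimately show ?thesis by metis
qed

section \<open>P4-free graphs split into a union or a join\<close>

definition P4_free :: "('v \<times> 'v) set \<Rightarrow> 'v set \<Rightarrow> bool" where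
  "P4_free E V \<longleftrightarrow> (\<forall>a\<in>V. \<forall>b\<in>V. \<forall>c\<in>V. \<forall>d\<in>V. \<not> (distinct [a, b, c, d] \<and>
     (a, b) \<in> E \<and> (b, c) \<in> E \<and> (c, d) \<in> E \<and> (a, c) \<notin> E \<and> (b, d) \<notin> E \<and> (a, d) \<notin> E))"

lemma P4_free_subset: "P4_free E V \<Longrightarrow> W \<subseteq> V \<Longrightarrow> P4_free E W"
  unfolding P4_free_def by (intro ballI) (simp only: subset_iff simp_thms)

lemma P4_freeD:
  assumes "P4_free E V" "distinct [a, b, c, d]" "a \<in> V" "b \<in> V" "c \<in> V" "d \<in> V"
    and "(a, b) \<in> E" "(b, c) \<in> E" "(c, d) \<in> E" "(a, c) \<notin> E" "(b, d) \<notin> E" "(a, d) \<notin> E"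
  shows False
  using bspec[OF bspec[OF bspec[OF bspec[OF assms(1)[unfolded P4_free_def] assms(3)] assms(4)] assms(5)] assms(6)]
    assms(2,7-12) by (simp only: simp_thms)

text \<open>\<open>\<beta> = False\<close>: the vertex set splits into two sets without edges between them;
  \<open>\<beta> = True\<close>: the same for the complement.\<close>

definition cutset :: "('v \<times> 'v) set \<Rightarrow> bool \<Rightarrow> 'v set \<Rightarrow> 'v set \<Rightarrow> bool" where
  "cutset E \<beta> X V \<longleftrightarrow> X \<noteq> {} \<and> X \<subset> V \<and> (\<forall>x\<in>X. \<forall>y\<in>V - X. (x, y) \<in> E \<longleftrightarrow> \<beta>)"

text \<open>Seinsche's theorem, by adding a vertex \<open>v\<close> to a set \<open>W\<close> that
  already has a cut: if the larger set has none, an induced path through \<open>v\<close>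
  appears.\<close>

lemma P4_free_cut:
  assumes "finite V" "2 \<le> card V" "P4_free E V" "sym E"
  shows "\<exists>\<beta> X. cutset E \<beta> X V"
  using assms(1-3)
proof (induction V rule: finite_induct)
  case (insert v W)
  show ?case
  proof (cases "2 \<le> card W")
    case False
    then have "card W = 1" using insert.hyps insert.prems(1) by simp
    then obtain w where "W = {w}" by (metis card_1_singletonE)
    then have "cutset E ((v, w) \<in> E) {v} (insert v W)" using insert.hyps(2) by (auto simp: cutset_def)
    then show ?thesis by blast
  next
    case True
    have sym: "(x, y) \<in> E \<longleftrightarrow> (y, x) \<in> E" for x y using assms(4) by (meson symD)
    obtain \<beta> X where X: "cutset E \<beta> X W"
      using insert.IH True P4_free_subset[OF insert.prems(2)] by blast
    \<comment> \<open>The kind of pair that does not cross the cut of \<open>W\<close>: edges if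
      \<open>\<beta>\<close> is \<open>False\<close>, non-edges otherwise. So \<open>W\<close> is
      disconnected for \<open>R\<close>, and both kinds of cut are treated at once.\<close>
    define R where "R x y \<longleftrightarrow> ((x, y) \<in> E) \<noteq> \<beta>" for x y
    have Rsym: "R x y \<longleftrightarrow> R y x" for x y using sym by (simp add: R_def)
    show ?thesis
    proof (rule ccontr)
      assume nocut: "\<nexists>\<beta> X. cutset E \<beta> X (insert v W)"
      define closed where "closed C \<longleftrightarrow> (\<forall>x\<in>C. \<forall>y\<in>W - C. \<not> R x y)" for C
      have closed_compl: "closed (W - C)" if "closed C" "C \<subseteq> W" for C
        using that Rsym unfolding closed_def by blast
      \<comment> \<open>Otherwise \<open>C\<close> would still be cut off after adding
        \<open>v\<close>.\<close>
      have nb: "\<exists>x\<in>C. R v x" if "closed C" "C \<subseteq> W" "C \<noteq> {}" for C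
      proof (rule ccontr)
        assume "\<not> (\<exists>x\<in>C. R v x)"
        then have "cutset E \<beta> C (insert v W)"
          using that insert.hyps(2) sym unfolding cutset_def closed_def R_def by blast
        then show False using nocut by blast
      qed
      obtain w0 where w0: "w0 \<in> W" using True by fastforce
      \<comment> \<open>Otherwise \<open>{v}\<close> itself would be a cut, of the opposite
        kind.\<close>
      have "\<exists>w\<in>W. \<not> R v w"
      proof (rule ccontr)
        assume "\<not> (\<exists>w\<in>W. \<not> R v w)"
        then have "cutset E (\<not> \<beta>) {v} (insert v W)"
          using w0 insert.hyps(2) unfolding cutset_def R_def by auto
        then show False using nocut by blast
      qed
      then obtain w where w: "w \<in> W" "\<not> R v w" by blast
      have "closed X" "X \<subset> W" "X \<noteq> {}" using X by (auto simp: cutset_def closed_def R_def)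
      then have half: "closed X" "closed (W - X)" "X \<subset> W" "W - X \<subset> W"
        using closed_compl[of X] by auto
      define P where "P C \<longleftrightarrow> closed C \<and> C \<subset> W \<and> w \<in> C" for C
      have "P X \<or> P (W - X)" using half w(1) by (auto simp: P_def)
      then obtain C0 where "P C0" by blast
      \<comment> \<open>A smallest closed proper subset around \<open>w\<close> plays the part of
        the component of \<open>w\<close>.\<close>
      from ex_has_least_nat[of P C0 card, OF this] obtain C
        where "P C" and least: "\<And>D. P D \<Longrightarrow> card C \<le> card D" by blast
      then have C: "closed C" "C \<subset> W" "w \<in> C" by (simp_all add: P_def)
      have finC: "finite C" using C(2) insert.hyps(1) by (meson finite_subset psubset_imp_subset)
      define X where "X = {x \<in> C. R v x}"
      have "X \<noteq> {}" using nb[of C] C unfolding X_def by blast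
      \<comment> \<open>Otherwise \<open>C - X\<close> would be closed, contain \<open>w\<close> and
        be smaller than \<open>C\<close>.\<close>
      have "\<exists>x\<in>X. \<exists>y\<in>C - X. R x y"
      proof (rule ccontr)
        assume no: "\<not> (\<exists>x\<in>X. \<exists>y\<in>C - X. R x y)"
        have "\<not> R u u'" if "u \<in> C - X" "u' \<in> W - (C - X)" for u u'
          using no C(1) Rsym that unfolding closed_def by (cases "u' \<in> X") blast+
        then have "closed (C - X)" unfolding closed_def by blast
        moreover have "w \<in> C - X" using C w unfolding X_def by blast
        moreover have "C - X \<subset> W" using C(2) by blast
        ultimately have "card C \<le> card (C - X)" using least by (simp add: P_def)
        moreover have "C - X \<subset> C" using \<open>X \<noteq> {}\<close> unfolding X_def by blast
        ultimately show False using psubset_card_mono[OF finC, of "C - X"] by simp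
      qed
      then obtain x y where xy: "x \<in> C" "R v x" "y \<in> C" "\<not> R v y" "R x y"
        unfolding X_def by blast
      obtain z where z: "z \<in> W" "z \<notin> C" "R v z"
        using nb[of "W - C"] closed_compl[of C] C by blast
      have "\<not> R x z" "\<not> R y z" using C z xy unfolding closed_def by blast+
      moreover have "x \<noteq> y" using xy by blast
      moreover have "x \<in> W" "y \<in> W" "v \<notin> W" using C xy insert.hyps(2) by auto
      ultimately have d: "distinct [z, v, x, y]" "distinct [x, z, y, v]" using z xy by auto
      have mem: "x \<in> insert v W" "y \<in> insert v W" "z \<in> insert v W" "v \<in> insert v W"
        using \<open>x \<in> W\<close> \<open>y \<in> W\<close> z by auto
      have R: "\<not> R z x" "\<not> R z y" "\<not> R y v" "R z v" "R x v"
        using \<open>\<not> R x z\<close> \<open>\<not> R y z\<close> xy z Rsym[of v y] Rsym[of x z] Rsym[of y z] Rsym[of v z]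
          Rsym[of v x] by simp_all
      \<comment> \<open>For \<open>R\<close> the induced path is \<open>z, v, x, y\<close>. If
        \<open>R\<close> means non-adjacency, the complementary path \<open>x, z, y, v\<close> is
        the one in \<open>E\<close>.\<close>
      show False
      proof (cases \<beta>)
        case False
        show False
          by (rule P4_freeD[OF insert.prems(2) d(1) mem(3,4,1,2)])
            (use R xy False in \<open>simp_all add: R_def\<close>)
      next
        case True
        show False
          by (rule P4_freeD[OF insert.prems(2) d(2) mem(1,3,2,4)])
            (use R xy \<open>\<not> R x z\<close> True in \<open>simp_all add: R_def\<close>)
      qed
    qed
  qed
qed simp

lemma rep_complete:
  assumes "finite V" "V \<noteq> {}" "P4_free E V" "sym E"
  shows "\<exists>b t. rep E b t V"
  using assms(1-3)
proof (induction "card V" arbitrary: V rule: less_induct)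
  case less
  show ?case
  proof (cases "2 \<le> card V")
    case False
    then have "card V = 1" using less.prems by (metis One_nat_def card_gt_0_iff less_2_cases not_less not_gr_zero less_numeral_extra(3))
    then obtain v where "V = {v}" by (metis card_1_singletonE)
    then show ?thesis using rep_Leaf[of E _ v] by blast
  next
    case True
    then obtain \<beta> X where X: "cutset E \<beta> X V" using P4_free_cut less.prems assms(4) by blast
    then have psub: "X \<subset> V" "V - X \<subset> V" "X \<noteq> {}" "V - X \<noteq> {}" by (auto simp: cutset_def)
    have sub: "\<exists>b t. rep E b t Y" if "Y \<subset> V" "Y \<noteq> {}" for Y
    proof (rule less.hyps)
      show "card Y < card V" using psubset_card_mono[OF less.prems(1) that(1)] .
      show "finite Y" using that(1) less.prems(1) finite_subset[of Y V] by blast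
      show "P4_free E Y" using P4_free_subset[OF less.prems(3), of Y] that(1) by blast
    qed (rule that(2))
    obtain b1 t1 where "rep E b1 t1 X" using sub[OF psub(1,3)] by blast
    moreover obtain b2 t2 where "rep E b2 t2 (V - X)" using sub[OF psub(2,4)] by blast
    ultimately have "\<exists>t. rep E \<beta> t (X \<union> (V - X))"
      by (rule rep_Un) (use X assms(4) in \<open>auto simp: cutset_def\<close>)
    moreover have "X \<union> (V - X) = V" using psub by blast
    ultimately show ?thesis by metis
  qed
qed

section \<open>Subtrees as modules\<close>

text \<open>A vertex in another part of the node sees the whole part around \<open>M\<close> alike;
  one in the same part is covered by induction.\<close>

lemma rep_subtree_module:
  assumes "rep E b t V" "s \<in> subtrees t"
  shows "\<exists>b' M. rep E b' s M \<and> M \<subseteq> V \<and>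
    (\<forall>v\<in>V - M. \<forall>x\<in>M. \<forall>y\<in>M. (v, x) \<in> E \<longleftrightarrow> (v, y) \<in> E)"
  using assms
proof (induction rule: rep.induct)
  case (rep_Leaf b v)
  then show ?case by (intro exI[of _ b] exI[of _ "{v}"]) (auto intro: rep.rep_Leaf)
next
  case (rep_Node ts As b)
  show ?case
  proof (cases "s = Node (mset ts)")
    case True
    moreover have "rep E b (Node (mset ts)) (\<Union> (set As))"
      by (rule rep.rep_Node) (use rep_Node.hyps in auto)
    ultimately show ?thesis by (intro exI[of _ b] exI[of _ "\<Union> (set As)"]) simp
  next
    case False
    then obtain i where i: "i < length ts" "s \<in> subtrees (ts ! i)"
      using rep_Node.prems by (auto simp: in_set_conv_nth)
    from rep_Node.IH[OF this] obtain b' M where M: "rep E b' s M" "M \<subseteq> As ! i"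
        "\<forall>v\<in>As ! i - M. \<forall>x\<in>M. \<forall>y\<in>M. (v, x) \<in> E \<longleftrightarrow> (v, y) \<in> E"
      by (elim exE conjE)
    have "(v, x) \<in> E \<longleftrightarrow> (v, y) \<in> E" if "v \<in> \<Union> (set As) - M" "x \<in> M" "y \<in> M" for v x y
    proof -
      have "v \<in> \<Union> (set As)" using that(1) by simp
      then obtain j where j: "j < length As" "v \<in> As ! j" by (metis UnionE in_set_conv_nth)
      show ?thesis
      proof (cases "j = i")
        case True
        then show ?thesis using M(3) that j by blast
      next
        case False
        then show ?thesis
          using separatedD(2)[OF rep_Node.hyps(4) j(1), of i v] M(2) that i j rep_Node.hyps(2) by auto
      qed
    qed
    moreover have "M \<subseteq> \<Union> (set As)" using M(2) i(1) rep_Node.hyps(2) nth_mem by (metis Union_upper subset_trans)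
    ultimately show ?thesis using M(1) by blast
  qed
qed

lemma rep_leaves_uniform:
  assumes "rep E b (Node M) V" "\<forall>t\<in>#M. t = Leaf" "u \<in> V" "v \<in> V" "u \<noteq> v"
  shows "(u, v) \<in> E \<longleftrightarrow> b"
  using assms(1)
proof (cases rule: rep.cases)
  case (rep_Node ts As)
  have sing: "\<exists>x. As ! i = {x}" if "i < length As" for i
  proof -
    have "ts ! i \<in># M" using that rep_Node by simp
    then have "ts ! i = Leaf" using assms(2) by simp
    then have "rep E (\<not> b) Leaf (As ! i)" using rep_Node(5)[of i] that rep_Node(4) by simp
    then show ?thesis by (cases rule: rep.cases) auto
  qed
  obtain i j where "i < length As" "u \<in> As ! i" "j < length As" "v \<in> As ! j"
    using assms(3,4) rep_Node(2) by (metis UnionE in_set_conv_nth)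
  moreover from this have "i \<noteq> j" using sing[of i] assms(5) by auto
  ultimately show ?thesis using separatedD(2)[OF rep_Node(6)] by blast
qed

lemma rep_leaf_and_child:
  assumes "rep E b (Node {#Leaf, t#}) V"
  shows "\<exists>c W. rep E (\<not> b) t W \<and> c \<notin> W \<and> V = insert c W \<and> (\<forall>w\<in>W. (c, w) \<in> E \<longleftrightarrow> b)"
  using assms
proof (cases rule: rep.cases)
  case (rep_Node ts As)
  have "mset ts = {#Leaf, t#}" using rep_Node(1) by simp
  from arg_cong[OF this, of size] have "length ts = 2" by simp
  then obtain s0 s1 where ts: "ts = [s0, s1]"
    by (auto simp: length_Suc_conv numeral_2_eq_2)
  then obtain A0 A1 where As: "As = [A0, A1]"
    using rep_Node(4) by (auto simp: length_Suc_conv)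
  have r: "rep E (\<not> b) s0 A0" "rep E (\<not> b) s1 A1"
    using rep_Node(5)[of 0] rep_Node(5)[of 1] ts As by simp_all
  have V: "V = A0 \<union> A1" using rep_Node(2) As by simp
  have sep: "A0 \<inter> A1 = {}" "\<And>x y. x \<in> A0 \<Longrightarrow> y \<in> A1 \<Longrightarrow> (x, y) \<in> E \<longleftrightarrow> b"
      "\<And>x y. x \<in> A1 \<Longrightarrow> y \<in> A0 \<Longrightarrow> (x, y) \<in> E \<longleftrightarrow> b"
    using separatedD[OF rep_Node(6), of 0 1] separatedD[OF rep_Node(6), of 1 0] As by simp_all
  have "{#s0, s1#} = {#Leaf, t#}" using rep_Node(1) ts by simp
  then consider "s0 = Leaf" "s1 = t" | "s1 = Leaf" "s0 = t"
    by (auto simp: add_eq_conv_ex)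
  then show ?thesis
  proof cases
    case 1
    obtain c where c: "A0 = {c}" using r(1) unfolding 1 by (cases rule: rep.cases)
    have "c \<notin> A1" "V = insert c A1" using c V sep(1) by simp_all
    moreover have "\<forall>w\<in>A1. (c, w) \<in> E \<longleftrightarrow> b" using c sep(2) by blast
    ultimately show ?thesis using 1(2) r(2) by blast
  next
    case 2
    obtain c where c: "A1 = {c}" using r(2) unfolding 2 by (cases rule: rep.cases)
    have "c \<notin> A0" "V = insert c A0" using c V sep(1) by simp_all
    moreover have "\<forall>w\<in>A0. (c, w) \<in> E \<longleftrightarrow> b" using c sep(3) by blast
    ultimately show ?thesis using 2(2) r(1) by blast
  qed
qed

subsection \<open>Cospectrality by a reflection\<close>

lemma same_eigenvalues_similar:
  assumes "similar_mat A B"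
  shows "same_eigenvalues A B"
proof -
  obtain n P Q where "{A, B, P, Q} \<subseteq> carrier_mat n n"
    using similar_matD[OF assms] by blast
  then have "A \<in> carrier_mat n n" "B \<in> carrier_mat n n" by auto
  then have "char_poly (map_mat complex_of_real A) = char_poly (map_mat complex_of_real B)"
    using of_real_hom.char_poly_hom char_poly_similar[OF assms] by metis
  then show ?thesis by (simp add: same_eigenvalues_def eig_mult_def)
qed

text \<open>Conjugation by the reflection \<open>1 - w w\<^sup>T / 6\<close>.\<close>

lemma similar_reflection:
  fixes w :: "nat \<Rightarrow> real"
  assumes w: "(\<Sum>k<n. w k * w k) = 12"
    and eq: "\<And>i j. i < n \<Longrightarrow> j < n \<Longrightarrow>
      a i j - (\<Sum>k<n. a i k * w k) * w j / 6 = b i j - w i * (\<Sum>k<n. w k * b k j) / 6"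
  shows "similar_mat (mat n n (\<lambda>(i, j). a i j)) (mat n n (\<lambda>(i, j). b i j))"
proof -
  define A where "A = mat n n (\<lambda>(i, j). a i j)"
  define B where "B = mat n n (\<lambda>(i, j). b i j)"
  \<comment> \<open>The 6 is half of the squared norm 12 of \<open>w\<close>, which makes
    \<open>U\<close> an involution.\<close>
  define U where "U = mat n n (\<lambda>(i, j). (if i = j then 1 else 0) - w i * w j / 6)"
  have carr: "A \<in> carrier_mat n n" "B \<in> carrier_mat n n" "U \<in> carrier_mat n n"
    by (auto simp: A_def B_def U_def)
  have XU: "(\<Sum>k<n. f k * ((if k = j then 1 else 0) - w k * w j / 6)) = f j - (\<Sum>k<n. f k * w k) * w j / 6"
    if "j < n" for f j
  proof -
    have "(\<Sum>k<n. f k * ((if k = j then 1 else 0) - w k * w j / 6))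
        = (\<Sum>k<n. (if k = j then f k else 0)) - (\<Sum>k<n. f k * w k * (w j / 6))"
      unfolding sum_subtractf[symmetric] by (intro sum.cong) (auto simp: algebra_simps)
    then show ?thesis using that by (simp add: sum_distrib_right)
  qed
  have UX: "(\<Sum>k<n. ((if i = k then 1 else 0) - w i * w k / 6) * f k) = f i - w i * (\<Sum>k<n. w k * f k) / 6"
    if "i < n" for f i
  proof -
    have "(\<Sum>k<n. ((if i = k then 1 else 0) - w i * w k / 6) * f k)
        = (\<Sum>k<n. (if i = k then f k else 0)) - (\<Sum>k<n. (w i / 6) * (w k * f k))"
      unfolding sum_subtractf[symmetric] by (intro sum.cong) (auto simp: algebra_simps)
    moreover have "(\<Sum>k<n. (w i / 6) * (w k * f k)) = (w i / 6) * (\<Sum>k<n. w k * f k)"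
      by (rule sum_distrib_left[symmetric])
    ultimately show ?thesis using that by simp
  qed
  have UU: "U * U = 1\<^sub>m n"
  proof (rule eq_matI)
    fix i j assume "i < dim_row (1\<^sub>m n :: real mat)" "j < dim_col (1\<^sub>m n :: real mat)"
    then have ij: "i < n" "j < n" by auto
    have "(U * U) $$ (i, j) = (\<Sum>k<n. ((if i = k then 1 else 0) - w i * w k / 6) *
        ((if k = j then 1 else 0) - w k * w j / 6))"
      using ij by (simp add: U_def scalar_prod_def atLeast0LessThan)
    also have "\<dots> = ((if i = j then 1 else 0) - w i * w j / 6)
        - w i * (\<Sum>k<n. w k * ((if k = j then 1 else 0) - w k * w j / 6)) / 6"
      by (rule UX[OF ij(1)])
    also have "\<dots> = (if i = j then 1 else 0)"
      by (simp only: XU[OF ij(2)] w) (simp add: field_simps)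
    finally show "(U * U) $$ (i, j) = 1\<^sub>m n $$ (i, j)" using ij by simp
  qed (auto simp: U_def)
  \<comment> \<open>\<open>eq\<close> is this identity read entrywise; in the form
    \<open>A * U = U * B\<close> each side has only one sum over \<open>w\<close>.\<close>
  have AU: "A * U = U * B"
  proof (rule eq_matI)
    fix i j assume "i < dim_row (U * B)" "j < dim_col (U * B)"
    then have ij: "i < n" "j < n" by (auto simp: U_def B_def)
    have "(A * U) $$ (i, j) = (\<Sum>k<n. a i k * ((if k = j then 1 else 0) - w k * w j / 6))"
      using ij by (simp add: A_def U_def scalar_prod_def atLeast0LessThan)
    also have "\<dots> = (\<Sum>k<n. ((if i = k then 1 else 0) - w i * w k / 6) * b k j)"
      using eq[OF ij] unfolding XU[OF ij(2)] UX[OF ij(1)] .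
    also have "\<dots> = (U * B) $$ (i, j)"
      using ij by (simp add: B_def U_def scalar_prod_def atLeast0LessThan)
    finally show "(A * U) $$ (i, j) = (U * B) $$ (i, j)" .
  qed (auto simp: A_def B_def U_def)
  have "A = A * (U * U)" using carr UU by simp
  also have "\<dots> = A * U * U" using carr by simp
  finally have "A = U * B * U" using AU by simp
  then show ?thesis
    using carr UU unfolding A_def[symmetric] B_def[symmetric]
    by (intro similar_matI[of _ _ U U n]) auto
qed

lemma graph_on_compl: "graph_on n E \<Longrightarrow> graph_on n (graph_compl n E)"
  by (auto simp: graph_on_def graph_compl_def)

lemma graph_compl_compl: "graph_on n E \<Longrightarrow> graph_compl n (graph_compl n E) = E"
  by (auto simp: graph_on_def graph_compl_def)

lemma degree_compl:
  assumes "graph_on n E" "i < n"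
  shows "real (degree_in (graph_compl n E) i) = real n - 1 - real (degree_in E i)"
proof -
  let ?N = "{k. (i, k) \<in> E}"
  have N: "?N \<subseteq> {..<n} - {i}" using assms by (auto simp: graph_on_def)
  have "{k. (i, k) \<in> graph_compl n E} = ({..<n} - {i}) - ?N"
    using assms by (auto simp: graph_compl_def)
  then have "degree_in (graph_compl n E) i = card ({..<n} - {i}) - card ?N"
    unfolding degree_in_def using N by (simp add: card_Diff_subset finite_subset)
  moreover have "card ?N \<le> card ({..<n} - {i})" using N by (intro card_mono) auto
  moreover have "card ({..<n} - {i}) = n - 1" using assms(2) by simp
  ultimately show ?thesis using assms(2) by (simp add: degree_in_def of_nat_diff)
qed

abbreviation sl_entry :: "(nat \<times> nat) set \<Rightarrow> nat \<Rightarrow> nat \<Rightarrow> real" where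
  "sl_entry E i j \<equiv> (if (i, j) \<in> E then 1 else 0) + (if i = j then real (degree_in E i) else 0)"

lemma sl_entry_compl:
  assumes "graph_on n E" "i < n" "j < n"
  shows "sl_entry (graph_compl n E) i j = 1 + (if i = j then real n - 2 else 0) - sl_entry E i j"
proof (cases "i = j")
  case True
  then show ?thesis
    using assms degree_compl[OF assms(1,2)] by (auto simp: graph_on_def graph_compl_def)
next
  case False
  then show ?thesis using assms by (auto simp: graph_compl_def)
qed

text \<open>A reflection vector orthogonal to the all-ones vector also serves the complements, since
  the signless Laplacians of a graph and its complement add up to \<open>J + (n - 2) I\<close>.\<close>

lemma same_eigenvalues_reflection:
  fixes w :: "nat \<Rightarrow> real"
  assumes E: "graph_on n E" and F: "graph_on n F"
    and w: "(\<Sum>k<n. w k * w k) = 12" and w0: "(\<Sum>k<n. w k) = 0"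
    and eq: "\<And>i j. i < n \<Longrightarrow> j < n \<Longrightarrow>
      sl_entry E i j - (\<Sum>k<n. sl_entry E i k * w k) * w j / 6
      = sl_entry F i j - w i * (\<Sum>k<n. w k * sl_entry F k j) / 6"
  shows "same_eigenvalues (signless_laplacian n E) (signless_laplacian n F)"
    and "same_eigenvalues (signless_laplacian n (graph_compl n E)) (signless_laplacian n (graph_compl n F))"
proof -
  show "same_eigenvalues (signless_laplacian n E) (signless_laplacian n F)"
    unfolding signless_laplacian_def
    by (rule same_eigenvalues_similar, rule similar_reflection[OF w eq])
  have "same_eigenvalues (mat n n (\<lambda>(i, j). sl_entry (graph_compl n E) i j))
      (mat n n (\<lambda>(i, j). sl_entry (graph_compl n F) i j))"
  proof (rule same_eigenvalues_similar, rule similar_reflection[OF w])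
    fix i j assume ij: "i < n" "j < n"
    \<comment> \<open>The all-ones matrix contributes the sum of \<open>w\<close>, which is 0, so
      only a multiple of the identity is added to the negated row of \<open>E\<close>.\<close>
    have l: "(\<Sum>k<n. sl_entry (graph_compl n E) i k * w k) = (real n - 2) * w i - (\<Sum>k<n. sl_entry E i k * w k)"
    proof -
      have "(\<Sum>k<n. sl_entry (graph_compl n E) i k * w k)
          = (\<Sum>k<n. w k + (if i = k then (real n - 2) * w k else 0) - sl_entry E i k * w k)"
        using ij by (intro sum.cong refl) (subst sl_entry_compl[OF E], auto simp: algebra_simps)
      also have "\<dots> = (\<Sum>k<n. w k) + (\<Sum>k<n. if i = k then (real n - 2) * w k else 0)
          - (\<Sum>k<n. sl_entry E i k * w k)"
        by (simp only: sum_subtractf sum.distrib)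
      finally show ?thesis using ij w0 by simp
    qed
    have r: "(\<Sum>k<n. w k * sl_entry (graph_compl n F) k j) = (real n - 2) * w j - (\<Sum>k<n. w k * sl_entry F k j)"
    proof -
      have "(\<Sum>k<n. w k * sl_entry (graph_compl n F) k j)
          = (\<Sum>k<n. w k + (if k = j then (real n - 2) * w k else 0) - w k * sl_entry F k j)"
        using ij by (intro sum.cong refl) (subst sl_entry_compl[OF F], auto simp: algebra_simps)
      also have "\<dots> = (\<Sum>k<n. w k) + (\<Sum>k<n. if k = j then (real n - 2) * w k else 0)
          - (\<Sum>k<n. w k * sl_entry F k j)"
        by (simp only: sum_subtractf sum.distrib)
      finally show ?thesis using ij w0 by simp
    qed
    define s where "s = (\<Sum>k<n. sl_entry E i k * w k)"
    define t where "t = (\<Sum>k<n. w k * sl_entry F k j)"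
    have eq': "sl_entry E i j - s * w j / 6 = sl_entry F i j - w i * t / 6"
      using eq[OF ij] by (simp only: s_def t_def)
    show "sl_entry (graph_compl n E) i j - (\<Sum>k<n. sl_entry (graph_compl n E) i k * w k) * w j / 6
      = sl_entry (graph_compl n F) i j - w i * (\<Sum>k<n. w k * sl_entry (graph_compl n F) k j) / 6"
      unfolding l r sl_entry_compl[OF E ij] sl_entry_compl[OF F ij] s_def[symmetric] t_def[symmetric]
      using eq' by (simp only: left_diff_distrib right_diff_distrib diff_divide_distrib) (simp add: algebra_simps)
  qed
  then show "same_eigenvalues (signless_laplacian n (graph_compl n E)) (signless_laplacian n (graph_compl n F))"
    unfolding signless_laplacian_def .
qed

lemma same_eigenvalues_sym: "same_eigenvalues A B \<Longrightarrow> same_eigenvalues B A"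
  by (simp add: same_eigenvalues_def)

text \<open>Complementing a mate gives a mate of the complement. This reduces modules that induce
  the complement of a claw to claw modules.\<close>

lemma mate_of_compl:
  assumes E: "graph_on n E" and m: "has_gen_Q_cospectral_mate n (graph_compl n E)"
  shows "has_gen_Q_cospectral_mate n E"
proof -
  obtain H where H: "graph_on n H" "\<not> graph_iso n H (graph_compl n E)"
    "same_eigenvalues (signless_laplacian n H) (signless_laplacian n (graph_compl n E))"
    "same_eigenvalues (signless_laplacian n (graph_compl n H)) (signless_laplacian n E)"
    using m graph_compl_compl[OF E] by (auto simp: has_gen_Q_cospectral_mate_def)
  have "\<not> graph_iso n (graph_compl n H) E"
  proof
    assume "graph_iso n (graph_compl n H) E"
    then obtain p where p: "bij_betw p {0..<n} {0..<n}"
      "\<And>i j. i < n \<Longrightarrow> j < n \<Longrightarrow> (i, j) \<in> graph_compl n H \<longleftrightarrow> (p i, p j) \<in> E"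
      by (auto simp: graph_iso_def)
    have "(i, j) \<in> H \<longleftrightarrow> (p i, p j) \<in> graph_compl n E" if ij: "i < n" "j < n" for i j
    proof -
      have "p i < n" "p j < n" using p(1) ij by (auto dest: bij_betwE)
      moreover have "p i = p j \<longleftrightarrow> i = j" using p(1) ij by (auto simp: bij_betw_def inj_on_def)
      moreover have "(i, i) \<notin> H" using H(1) by (simp add: graph_on_def)
      ultimately show ?thesis using p(2)[OF ij] ij by (auto simp: graph_compl_def)
    qed
    then show False using H(2) p(1) by (auto simp: graph_iso_def)
  qed
  then show ?thesis
    using H graph_on_compl[OF H(1)] graph_compl_compl[OF H(1)]
    by (auto simp: has_gen_Q_cospectral_mate_def)
qed

lemma degree_iso:
  assumes "graph_on n E" "graph_on n F" "bij_betw p {0..<n} {0..<n}"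
    and "\<forall>i<n. \<forall>j<n. (i, j) \<in> E \<longleftrightarrow> (p i, p j) \<in> F" and "i < n"
  shows "degree_in F (p i) = degree_in E i"
proof -
  have "{k. (p i, k) \<in> F} = p ` {k. (i, k) \<in> E}"
  proof (intro equalityI subsetI)
    fix k assume "k \<in> {k. (p i, k) \<in> F}"
    moreover from this have "k \<in> p ` {0..<n}"
      using assms(2,3) by (auto simp: graph_on_def bij_betw_def)
    ultimately show "k \<in> p ` {k. (i, k) \<in> E}" using assms(4,5) by auto
  next
    fix k assume "k \<in> p ` {k. (i, k) \<in> E}"
    then show "k \<in> {k. (p i, k) \<in> F}" using assms(1,4,5) by (auto simp: graph_on_def)
  qed
  moreover have "inj_on p {k. (i, k) \<in> E}"
    using assms(1,3) by (auto simp: graph_on_def bij_betw_def intro: inj_on_subset)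
  ultimately show ?thesis by (simp add: degree_in_def card_image)
qed

text \<open>The invariant that will tell a graph from its mate.\<close>

lemma degree_count_iso:
  assumes "graph_on n E" "graph_on n F" "graph_iso n E F"
  shows "card {i. i < n \<and> degree_in E i = d} = card {i. i < n \<and> degree_in F i = d}"
proof -
  obtain p where p: "bij_betw p {0..<n} {0..<n}" "\<forall>i<n. \<forall>j<n. (i, j) \<in> E \<longleftrightarrow> (p i, p j) \<in> F"
    using assms(3) by (auto simp: graph_iso_def)
  note deg = degree_iso[OF assms(1,2) p]
  have "p ` {i. i < n \<and> degree_in E i = d} = {i. i < n \<and> degree_in F i = d}"
  proof (intro equalityI subsetI)
    fix k assume k: "k \<in> {i. i < n \<and> degree_in F i = d}"
    then have "k \<in> p ` {0..<n}" using p(1) by (simp add: bij_betw_def)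
    then obtain i where "i < n" "k = p i" by auto
    then show "k \<in> p ` {i. i < n \<and> degree_in E i = d}" using k deg by auto
  qed (use deg p(1) in \<open>auto dest: bij_betwE\<close>)
  moreover have "inj_on p {i. i < n \<and> degree_in E i = d}"
    using p(1) by (auto simp: bij_betw_def intro: inj_on_subset)
  then have "card (p ` {i. i < n \<and> degree_in E i = d}) = card {i. i < n \<and> degree_in E i = d}"
    by (rule card_image)
  ultimately show ?thesis by simp
qed

subsection \<open>Claw modules\<close>

locale claw_module =
  fixes n :: nat and E :: "(nat \<times> nat) set" and c x y z :: nat
  assumes E: "graph_on n E"
    and lt: "c < n" "x < n" "y < n" "z < n"
    and dist: "distinct [c, x, y, z]"
    and edges: "(c, x) \<in> E" "(c, y) \<in> E" "(c, z) \<in> E"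
    and non_edges: "(x, y) \<notin> E" "(x, z) \<notin> E" "(y, z) \<notin> E"
    and module: "\<And>v. v < n \<Longrightarrow> v \<notin> {c, x, y, z} \<Longrightarrow>
      ((v, x) \<in> E \<longleftrightarrow> (v, c) \<in> E) \<and> ((v, y) \<in> E \<longleftrightarrow> (v, c) \<in> E) \<and> ((v, z) \<in> E \<longleftrightarrow> (v, c) \<in> E)"
begin

definition S :: "nat set" where "S = {c, x, y, z}"

definition F :: "(nat \<times> nat) set" where
  "F = (E - S \<times> S) \<union> {(x, y), (y, x), (x, z), (z, x), (y, z), (z, y)}"

text \<open>Up to adding \<open>r\<close> times the identity, the blocks of \<open>E\<close> and
  \<open>F\<close> on the module both have eigenvalues 4, 1, 1, 0. For 4 they have the eigenvectors
  \<open>(3, 1, 1, 1)\<close> and \<open>(0, 2, 2, 2)\<close>, for 0 the eigenvectors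
  \<open>(1, -1, -1, -1)\<close> and \<open>(-2, 0, 0, 0)\<close>. Each pair has equal lengths and
  difference \<open>w\<close>, so one reflection swaps both; the eigenspace of 1 is common and
  orthogonal to \<open>w\<close>.\<close>

definition w :: "nat \<Rightarrow> real" where
  "w i = (if i = c then 3 else if i \<in> {x, y, z} then -1 else 0)"

definition r :: nat where "r = card {k. (c, k) \<in> E \<and> k \<notin> S}"

lemma E_sym: "(i, j) \<in> E \<longleftrightarrow> (j, i) \<in> E"
  and E_irrefl: "(i, i) \<notin> E"
  and E_lt: "(i, j) \<in> E \<Longrightarrow> i < n \<and> j < n"
  using E by (auto simp: graph_on_def)

lemma neq: "c \<noteq> x" "c \<noteq> y" "c \<noteq> z" "x \<noteq> y" "x \<noteq> z" "y \<noteq> z"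
    "x \<noteq> c" "y \<noteq> c" "z \<noteq> c" "y \<noteq> x" "z \<noteq> x" "z \<noteq> y"
  using dist by auto

lemma E_inside:
  "(c, x) \<in> E" "(c, y) \<in> E" "(c, z) \<in> E" "(x, c) \<in> E" "(y, c) \<in> E" "(z, c) \<in> E"
  "(x, y) \<notin> E" "(x, z) \<notin> E" "(y, z) \<notin> E" "(y, x) \<notin> E" "(z, x) \<notin> E" "(z, y) \<notin> E"
  using edges non_edges E_sym by blast+

lemma F_outside: "i \<notin> S \<or> j \<notin> S \<Longrightarrow> (i, j) \<in> F \<longleftrightarrow> (i, j) \<in> E"
  by (auto simp: F_def S_def)

lemma F_inside:
  "(c, x) \<notin> F" "(c, y) \<notin> F" "(c, z) \<notin> F" "(x, c) \<notin> F" "(y, c) \<notin> F" "(z, c) \<notin> F"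
  "(x, y) \<in> F" "(x, z) \<in> F" "(y, z) \<in> F" "(y, x) \<in> F" "(z, x) \<in> F" "(z, y) \<in> F"
  "(c, c) \<notin> F" "(x, x) \<notin> F" "(y, y) \<notin> F" "(z, z) \<notin> F"
  using neq by (auto simp: F_def S_def)

lemma graph_on_F: "graph_on n F"
  unfolding graph_on_def
proof (intro conjI allI impI)
  show "F \<subseteq> {0..<n} \<times> {0..<n}" using E_lt lt by (auto simp: F_def)
  show "(j, i) \<in> F" if "(i, j) \<in> F" for i j using that E_sym by (auto simp: F_def)
  show "(i, i) \<notin> F" for i using E_irrefl neq by (auto simp: F_def)
qed

lemma module': "v \<notin> S \<Longrightarrow> i \<in> S \<Longrightarrow> (v, i) \<in> E \<longleftrightarrow> (v, c) \<in> E"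
  using module[of v] E_lt unfolding S_def by blast

lemma outer_neighbours: "i \<in> S \<Longrightarrow> {k. (i, k) \<in> E \<and> k \<notin> S} = {k. (c, k) \<in> E \<and> k \<notin> S}"
  using module' E_sym by blast

lemma finite_outer: "finite {k. (i, k) \<in> E \<and> P k}"
  by (rule finite_subset[of _ "{..<n}"]) (auto dest: E_lt)

lemma degree_split:
  assumes "i \<in> S" "\<And>k. k \<notin> S \<Longrightarrow> (i, k) \<in> H \<longleftrightarrow> (i, k) \<in> E"
  shows "degree_in H i = r + card {k \<in> S. (i, k) \<in> H}"
proof -
  have "{k. (i, k) \<in> H} = {k. (i, k) \<in> E \<and> k \<notin> S} \<union> {k \<in> S. (i, k) \<in> H}"
    using assms(2) by blast
  moreover have "finite {k \<in> S. (i, k) \<in> H}" by (simp add: S_def)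
  ultimately have "degree_in H i = card {k. (i, k) \<in> E \<and> k \<notin> S} + card {k \<in> S. (i, k) \<in> H}"
    unfolding degree_in_def using finite_outer by (simp only:) (rule card_Un_disjoint, auto)
  then show ?thesis using outer_neighbours[OF assms(1)] by (simp add: r_def)
qed

lemma degree_E: "degree_in E c = r + 3" "degree_in E x = r + 1" "degree_in E y = r + 1" "degree_in E z = r + 1"
proof -
  have "{k \<in> S. (c, k) \<in> E} = {x, y, z}" "{k \<in> S. (x, k) \<in> E} = {c}"
    "{k \<in> S. (y, k) \<in> E} = {c}" "{k \<in> S. (z, k) \<in> E} = {c}"
    using E_inside E_irrefl by (auto simp: S_def)
  moreover have "degree_in E i = r + card {k \<in> S. (i, k) \<in> E}" if "i \<in> S" for i
    by (rule degree_split[OF that refl])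
  moreover have "c \<in> S" "x \<in> S" "y \<in> S" "z \<in> S" by (auto simp: S_def)
  ultimately show "degree_in E c = r + 3" "degree_in E x = r + 1" "degree_in E y = r + 1" "degree_in E z = r + 1"
    using neq by simp_all
qed

lemma degree_F: "degree_in F c = r" "degree_in F x = r + 2" "degree_in F y = r + 2" "degree_in F z = r + 2"
proof -
  have "{k \<in> S. (c, k) \<in> F} = {}" "{k \<in> S. (x, k) \<in> F} = {y, z}"
    "{k \<in> S. (y, k) \<in> F} = {x, z}" "{k \<in> S. (z, k) \<in> F} = {x, y}"
    using F_inside by (auto simp: S_def)
  then have "card {k \<in> S. (c, k) \<in> F} = 0" "card {k \<in> S. (x, k) \<in> F} = 2"
    "card {k \<in> S. (y, k) \<in> F} = 2" "card {k \<in> S. (z, k) \<in> F} = 2"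
    using neq by (simp_all only:) simp_all
  moreover have "degree_in F i = r + card {k \<in> S. (i, k) \<in> F}" if "i \<in> S" for i
    by (rule degree_split[OF that]) (rule F_outside, rule disjI2)
  moreover have "c \<in> S" "x \<in> S" "y \<in> S" "z \<in> S" by (auto simp: S_def)
  ultimately show "degree_in F c = r" "degree_in F x = r + 2" "degree_in F y = r + 2" "degree_in F z = r + 2"
    by simp_all
qed

lemma degree_F_outside: "i \<notin> S \<Longrightarrow> degree_in F i = degree_in E i"
  using F_outside by (simp add: degree_in_def)

lemma not_iso: "\<not> graph_iso n F E"
proof
  assume "graph_iso n F E"
  then have *: "card {i. i < n \<and> degree_in F i = r + 3} = card {i. i < n \<and> degree_in E i = r + 3}"
    using degree_count_iso[OF graph_on_F E] by blast
  \<comment> \<open>Degrees outside \<open>S\<close> agree. Inside, \<open>E\<close> has the degrees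
    \<open>r + 3\<close> and \<open>r + 1\<close>, but \<open>F\<close> has \<open>r\<close> and
    \<open>r + 2\<close>, so \<open>c\<close> in \<open>E\<close> is the only vertex of
    \<open>S\<close> with degree \<open>r + 3\<close>.\<close>
  let ?R = "{i. i < n \<and> degree_in E i = r + 3 \<and> i \<notin> S}"
  have "{i. i < n \<and> degree_in F i = r + 3} = ?R"
  proof (rule Set.set_eqI)
    fix i
    show "i \<in> {i. i < n \<and> degree_in F i = r + 3} \<longleftrightarrow> i \<in> ?R"
    proof (cases "i \<in> S")
      case True
      then have "degree_in F i \<noteq> r + 3" using degree_F by (auto simp: S_def)
      then show ?thesis using True by simp
    next
      case False
      then show ?thesis using degree_F_outside by simp
    qed
  qed
  moreover have "{i. i < n \<and> degree_in E i = r + 3} = insert c ?R"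
  proof (rule Set.set_eqI)
    fix i
    show "i \<in> {i. i < n \<and> degree_in E i = r + 3} \<longleftrightarrow> i \<in> insert c ?R"
    proof (cases "i \<in> S")
      case True
      then have "degree_in E i = r + 3 \<longleftrightarrow> i = c" using degree_E neq by (auto simp: S_def)
      then show ?thesis using True lt(1) by auto
    next
      case False
      then show ?thesis by (auto simp: S_def)
    qed
  qed
  ultimately show False using * by (simp add: S_def)
qed

lemma module_F:
  assumes "v \<notin> S" "i \<in> S"
  shows "(i, v) \<in> F \<longleftrightarrow> (c, v) \<in> F"
proof -
  have "(i, v) \<in> F \<longleftrightarrow> (i, v) \<in> E" "(c, v) \<in> F \<longleftrightarrow> (c, v) \<in> E"
    by (rule F_outside, rule disjI2, rule assms(1))+
  moreover have "(i, v) \<in> E \<longleftrightarrow> (v, i) \<in> E" "(c, v) \<in> E \<longleftrightarrow> (v, c) \<in> E" by (rule E_sym)+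
  ultimately show ?thesis using module'[OF assms] by blast
qed

lemma sum_w: "(\<Sum>k<n. f k * w k) = 3 * f c - f x - f y - f z"
proof -
  have "(\<Sum>k<n. f k * w k) = (\<Sum>k\<in>S. f k * w k)"
    by (rule sum.mono_neutral_right) (use lt in \<open>auto simp: S_def w_def\<close>)
  also have "\<dots> = 3 * f c - f x - f y - f z"
    using neq by (simp add: S_def w_def)
  finally show ?thesis .
qed

lemma sum_w': "(\<Sum>k<n. w k * f k) = 3 * f c - f x - f y - f z"
  using sum_w[of f] by (simp only: mult.commute)

lemma w_vals: "w c = 3" "w x = -1" "w y = -1" "w z = -1" "i \<notin> S \<Longrightarrow> w i = 0"
  using neq by (auto simp: w_def S_def)

text \<open>A row outside the module is constant on \<open>S\<close>, hence orthogonal to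
  \<open>w\<close>; a row inside meets only the block of the module.\<close>

lemma row_E:
  "(\<Sum>k<n. sl_entry E c k * w k) = 3 * real r + 6"
  "(\<Sum>k<n. sl_entry E x k * w k) = 2 - real r"
  "(\<Sum>k<n. sl_entry E y k * w k) = 2 - real r"
  "(\<Sum>k<n. sl_entry E z k * w k) = 2 - real r"
  "i \<notin> S \<Longrightarrow> (\<Sum>k<n. sl_entry E i k * w k) = 0"
proof -
  show "(\<Sum>k<n. sl_entry E i k * w k) = 0" if "i \<notin> S"
  proof -
    have "i \<noteq> c" "i \<noteq> x" "i \<noteq> y" "i \<noteq> z" using that by (auto simp: S_def)
    moreover have "(i, x) \<in> E \<longleftrightarrow> (i, c) \<in> E" "(i, y) \<in> E \<longleftrightarrow> (i, c) \<in> E" "(i, z) \<in> E \<longleftrightarrow> (i, c) \<in> E"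
      by (rule module'[OF that], simp add: S_def)+
    ultimately show ?thesis unfolding sum_w by simp
  qed
qed (unfold sum_w, simp_all add: E_inside E_irrefl degree_E neq)

lemma col_F:
  "(\<Sum>k<n. w k * sl_entry F k c) = 3 * real r"
  "(\<Sum>k<n. w k * sl_entry F k x) = - real r - 4"
  "(\<Sum>k<n. w k * sl_entry F k y) = - real r - 4"
  "(\<Sum>k<n. w k * sl_entry F k z) = - real r - 4"
  "i \<notin> S \<Longrightarrow> (\<Sum>k<n. w k * sl_entry F k i) = 0"
proof -
  show "(\<Sum>k<n. w k * sl_entry F k i) = 0" if "i \<notin> S"
  proof -
    have "i \<noteq> c" "i \<noteq> x" "i \<noteq> y" "i \<noteq> z" using that by (auto simp: S_def)
    moreover have "(x, i) \<in> F \<longleftrightarrow> (c, i) \<in> F" "(y, i) \<in> F \<longleftrightarrow> (c, i) \<in> F" "(z, i) \<in> F \<longleftrightarrow> (c, i) \<in> F"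
      by (rule module_F[OF that], simp add: S_def)+
    ultimately show ?thesis unfolding sum_w' by simp
  qed
qed (unfold sum_w', simp_all add: F_inside degree_F neq)

text \<open>Off the block of \<open>S\<close> both corrections vanish and the entries of
  \<open>E\<close> and \<open>F\<close> agree; on it the 16 cases are computed.\<close>

lemma reflection_identity:
  "sl_entry E i j - (\<Sum>k<n. sl_entry E i k * w k) * w j / 6
    = sl_entry F i j - w i * (\<Sum>k<n. w k * sl_entry F k j) / 6"
proof (cases "i \<in> S \<and> j \<in> S")
  case True
  then have "i = c \<or> i = x \<or> i = y \<or> i = z" "j = c \<or> j = x \<or> j = y \<or> j = z"
    by (auto simp: S_def)
  then show ?thesis
    by (elim disjE; simp only: row_E col_F w_vals)
      (simp_all add: E_inside E_irrefl F_inside degree_E degree_F neq field_simps)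
next
  case False
  then have zero: "(\<Sum>k<n. sl_entry E i k * w k) * w j = 0" "w i * (\<Sum>k<n. w k * sl_entry F k j) = 0"
    using row_E(5)[of i] w_vals(5)[of i] w_vals(5)[of j] col_F(5)[of j] by auto
  have "sl_entry E i j = sl_entry F i j"
    using False F_outside[of i j] degree_F_outside[of i] by auto
  then show ?thesis by (simp only: zero)
qed

lemma has_mate: "has_gen_Q_cospectral_mate n E"
proof -
  have w12: "(\<Sum>k<n. w k * w k) = 12" and w0: "(\<Sum>k<n. w k) = 0"
    using sum_w[of w] sum_w[of "\<lambda>_. 1"] by (simp_all add: w_vals)
  show ?thesis
    unfolding has_gen_Q_cospectral_mate_def
    using same_eigenvalues_reflection[OF E graph_on_F w12 w0 reflection_identity]
      graph_on_F not_iso same_eigenvalues_sym by blast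
qed

end

subsection \<open>Counting isomorphism classes\<close>

text \<open>As trees carry no labels, this is the claw when the root is a join, and its complement,
  a triangle with an isolated vertex, when the root is a union.\<close>

definition claw_tree :: tree where
  "claw_tree = Node {#Leaf, Node {#Leaf, Leaf, Leaf#}#}"

lemma reduced_claw_tree: "reduced claw_tree"
  by (simp add: claw_tree_def reduced_Node_iff reduced_Leaf)

lemma mate_of_claw_subtree:
  assumes E: "graph_on n E" and rep: "rep E b t {0..<n}" and sub: "claw_tree \<in> subtrees t"
  shows "has_gen_Q_cospectral_mate n E"
proof -
  from rep_subtree_module[OF rep sub] obtain b' M where M: "rep E b' claw_tree M" "M \<subseteq> {0..<n}"
    and mod: "\<forall>v\<in>{0..<n} - M. \<forall>u\<in>M. \<forall>u'\<in>M. (v, u) \<in> E \<longleftrightarrow> (v, u') \<in> E"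
    by (elim exE conjE)
  from rep_leaf_and_child[OF M(1)[unfolded claw_tree_def]]
  obtain c W where W: "rep E (\<not> b') (Node {#Leaf, Leaf, Leaf#}) W" "c \<notin> W" "M = insert c W"
      "\<forall>u\<in>W. (c, u) \<in> E \<longleftrightarrow> b'"
    by (elim exE conjE)
  have "card W = 3" using rep_card[OF W(1)] by simp
  then obtain x y z where xyz: "W = {x, y, z}" "x \<noteq> y" "y \<noteq> z" "x \<noteq> z"
    by (auto simp: card_3_iff)
  have inner: "(u, v) \<in> E \<longleftrightarrow> \<not> b'" if "u \<in> W" "v \<in> W" "u \<noteq> v" for u v
    using rep_leaves_uniform[OF W(1) _ that] by simp
  have lt: "c < n" "x < n" "y < n" "z < n" using M(2) W(3) xyz(1) by auto
  have dist: "distinct [c, x, y, z]" using W(2) xyz by auto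
  have module: "((v, x) \<in> E \<longleftrightarrow> (v, c) \<in> E) \<and> ((v, y) \<in> E \<longleftrightarrow> (v, c) \<in> E) \<and> ((v, z) \<in> E \<longleftrightarrow> (v, c) \<in> E)"
    if "v < n" "v \<notin> {c, x, y, z}" for v
  proof -
    have v: "v \<in> {0..<n} - M" using that W(3) xyz(1) by simp
    have "c \<in> M" "x \<in> M" "y \<in> M" "z \<in> M" using W(3) xyz(1) by simp_all
    then show ?thesis using mod[THEN bspec, OF v] by blast
  qed
  show ?thesis
  \<comment> \<open>With a union at the root, the claw is found in the complement of
    \<open>E\<close>.\<close>
  proof (cases b')
    case True
    have "claw_module n E c x y z"
      by unfold_locales
        (use E lt dist W(4) inner module True xyz in \<open>simp_all\<close>)
    then show ?thesis by (rule claw_module.has_mate)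
  next
    case False
    have "claw_module n (graph_compl n E) c x y z"
      by unfold_locales
        (use graph_on_compl[OF E] lt dist W(4) inner module False xyz in \<open>auto simp: graph_compl_def\<close>)
    then show ?thesis using mate_of_compl[OF E] claw_module.has_mate by blast
  qed
qed

lemma sym_graph_on: "graph_on n E \<Longrightarrow> sym E"
  by (auto simp: graph_on_def sym_def)

lemma cograph_rep:
  assumes "cograph n E" "1 \<le> n"
  shows "\<exists>b t. rep E b t {0..<n} \<and> t \<in> trees n"
proof -
  have "P4_free E {0..<n}"
    using assms(1) unfolding cograph_def P4_free_def by (meson atLeastLessThan_iff)
  then obtain b t where r: "rep E b t {0..<n}"
    using rep_complete[of "{0..<n}" E] assms by (auto simp: cograph_def dest: sym_graph_on)
  then have "t \<in> trees n" using rep_card[OF r] rep_reduced[OF r] by (simp add: trees_def)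
  then show ?thesis using r by blast
qed

lemma cograph_of_tree:
  assumes "t \<in> trees n"
  shows "\<exists>E. cograph n E \<and> rep E True t {0..<n}"
proof -
  obtain F :: "(nat \<times> nat) set" and V where F: "sym F" "irrefl F" "rep F True t V"
    using rep_exists[of t True] assms by (auto simp: trees_def)
  have "card V = n" using rep_card[OF F(3)] assms by (simp add: trees_def)
  then obtain p where p: "bij_betw p V {0..<n}"
    using ex_bij_betw_finite_nat[OF rep_finite[OF F(3)]] by auto
  define E where "E = {(p u, p v) |u v. u \<in> V \<and> v \<in> V \<and> (u, v) \<in> F}"
  have inj: "inj_on p V" and im: "p ` V = {0..<n}" using p by (auto simp: bij_betw_def)
  have iff: "(u, v) \<in> F \<longleftrightarrow> (p u, p v) \<in> E" if "u \<in> V" "v \<in> V" for u v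
    using that inj unfolding E_def inj_on_def by blast
  have "rep E True t (p ` V)" using rep_transfer[OF F(3) inj iff] .
  then have r: "rep E True t {0..<n}" using im by simp
  have g: "graph_on n E"
    unfolding graph_on_def
  proof (intro conjI allI impI)
    show "E \<subseteq> {0..<n} \<times> {0..<n}" using im by (auto simp: E_def)
    show "(j, i) \<in> E" if "(i, j) \<in> E" for i j using that F(1) by (auto simp: E_def dest: symD)
    show "(i, i) \<notin> E" for i
      using F(2) inj by (auto simp: E_def irrefl_def dest: inj_onD)
  qed
  have "cograph n E"
    unfolding cograph_def
  proof (intro conjI notI g)
    assume "\<exists>a b c d. distinct [a,b,c,d] \<and> a < n \<and> b < n \<and> c < n \<and> d < n \<and>
          (a,b) \<in> E \<and> (b,c) \<in> E \<and> (c,d) \<in> E \<and>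
          (a,c) \<notin> E \<and> (b,d) \<notin> E \<and> (a,d) \<notin> E"
    then obtain a b c d where P: "distinct [a,b,c,d]" "a < n" "b < n" "c < n" "d < n"
      "(a,b) \<in> E" "(b,c) \<in> E" "(c,d) \<in> E" "(a,c) \<notin> E" "(b,d) \<notin> E" "(a,d) \<notin> E" by blast
    show False
      by (rule rep_P4_free[OF r sym_graph_on[OF g], of a b c d]) (use P in simp_all)
  qed
  then show ?thesis using r by blast
qed

section \<open>Isomorphism classes against trees\<close>

lemma equiv_iso_rel: "equiv {E. graph_on n E} (iso_rel n)"
proof (rule equivI)
  show "iso_rel n \<subseteq> {E. graph_on n E} \<times> {E. graph_on n E}" by (auto simp: iso_rel_def)
  show "refl_on {E. graph_on n E} (iso_rel n)"
    by (auto simp: refl_on_def iso_rel_def graph_iso_def intro!: exI[of _ id])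
  show "sym (iso_rel n)"
  proof (rule symI)
    fix E F assume EF: "(E, F) \<in> iso_rel n"
    then obtain p where p: "bij_betw p {0..<n} {0..<n}"
      "\<And>i j. i < n \<Longrightarrow> j < n \<Longrightarrow> (i, j) \<in> E \<longleftrightarrow> (p i, p j) \<in> F"
      by (auto simp: iso_rel_def graph_iso_def)
    let ?q = "the_inv_into {0..<n} p"
    have q: "bij_betw ?q {0..<n} {0..<n}" by (rule bij_betw_the_inv_into[OF p(1)])
    have "(i, j) \<in> F \<longleftrightarrow> (?q i, ?q j) \<in> E" if "i < n" "j < n" for i j
    proof -
      have "?q i < n" "?q j < n" using q that by (auto dest: bij_betwE)
      moreover have "p (?q i) = i" "p (?q j) = j"
        using that p(1) f_the_inv_into_f_bij_betw[OF p(1)] by auto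
      ultimately show ?thesis using p(2) by metis
    qed
    then show "(F, E) \<in> iso_rel n" using EF q by (auto simp: iso_rel_def graph_iso_def)
  qed
  show "trans (iso_rel n)"
  proof (rule transI)
    fix E F G assume EFG: "(E, F) \<in> iso_rel n" "(F, G) \<in> iso_rel n"
    then obtain p q where p: "bij_betw p {0..<n} {0..<n}"
      "\<And>i j. i < n \<Longrightarrow> j < n \<Longrightarrow> (i, j) \<in> E \<longleftrightarrow> (p i, p j) \<in> F"
      and q: "bij_betw q {0..<n} {0..<n}"
      "\<And>i j. i < n \<Longrightarrow> j < n \<Longrightarrow> (i, j) \<in> F \<longleftrightarrow> (q i, q j) \<in> G"
      by (auto simp: iso_rel_def graph_iso_def)
    have "(i, j) \<in> E \<longleftrightarrow> ((q \<circ> p) i, (q \<circ> p) j) \<in> G" if "i < n" "j < n" for i j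
    proof -
      have "p i < n" "p j < n" using p(1) that by (auto dest: bij_betwE)
      then show ?thesis using p(2)[OF that] q(2) by simp
    qed
    moreover have "bij_betw (q \<circ> p) {0..<n} {0..<n}" using bij_betw_trans[OF p(1) q(1)] .
    ultimately show "(E, G) \<in> iso_rel n"
      using EFG unfolding iso_rel_def graph_iso_def by blast
  qed
qed

lemma finite_iso_classes: "finite ({E. graph_on n E \<and> P E} // iso_rel n)"
proof -
  have "finite {E. graph_on n E \<and> P E}"
    by (rule finite_subset[of _ "Pow ({0..<n} \<times> {0..<n})"]) (auto simp: graph_on_def)
  then show ?thesis unfolding quotient_def by simp
qed

lemma iso_class_eq_iff:
  assumes "graph_on n E" "graph_on n F"
  shows "iso_rel n `` {E} = iso_rel n `` {F} \<longleftrightarrow> graph_iso n E F"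
  using eq_equiv_class_iff[OF equiv_iso_rel, of E n F] assms by (simp add: iso_rel_def)

lemma graph_iso_rep:
  assumes "rep E b t {0..<n}" "rep F b t {0..<n}" "graph_on n E" "graph_on n F"
  shows "graph_iso n E F"
  using rep_iso[OF assms(1,2)] assms(3,4) by (auto simp: graph_iso_def graph_on_def)

text \<open>An isomorphism carries a cotree over, so by \<open>rep_unique\<close> different trees
  give different classes. Fixing the root label \<open>True\<close> loses at most a factor
  2.\<close>

lemma card_trees_le_num_cographs: "card (trees n) \<le> num_cographs n"
  unfolding num_cographs_def
proof (rule card_le_by_code[where R = "\<lambda>t X. \<exists>E. cograph n E \<and> rep E True t {0..<n} \<and> X = iso_rel n `` {E}"])
  show "finite ({E. cograph n E} // iso_rel n)"
    unfolding cograph_def by (rule finite_iso_classes)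
next
  fix t assume "t \<in> trees n"
  then obtain E where "cograph n E" "rep E True t {0..<n}" using cograph_of_tree by blast
  then show "\<exists>X\<in>{E. cograph n E} // iso_rel n. \<exists>E. cograph n E \<and> rep E True t {0..<n} \<and> X = iso_rel n `` {E}"
    by (intro bexI[of _ "iso_rel n `` {E}"] exI[of _ E] conjI quotientI) simp_all
next
  fix t s X
  assume "\<exists>E. cograph n E \<and> rep E True t {0..<n} \<and> X = iso_rel n `` {E}"
    and "\<exists>E. cograph n E \<and> rep E True s {0..<n} \<and> X = iso_rel n `` {E}"
  then obtain E F where E: "cograph n E" "rep E True t {0..<n}"
    and F: "cograph n F" "rep F True s {0..<n}" and "iso_rel n `` {E} = iso_rel n `` {F}" by metis
  then have "graph_iso n E F" using iso_class_eq_iff by (simp add: cograph_def)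
  then obtain p where p: "bij_betw p {0..<n} {0..<n}"
    "\<And>i j. i < n \<Longrightarrow> j < n \<Longrightarrow> (i, j) \<in> E \<longleftrightarrow> (p i, p j) \<in> F"
    by (auto simp: graph_iso_def)
  have "rep F True t (p ` {0..<n})"
    by (rule rep_transfer[OF E(2)]) (use p in \<open>auto simp: bij_betw_def\<close>)
  then have "rep F True t {0..<n}" using p(1) by (simp add: bij_betw_def)
  then show "t = s" using rep_unique F(2) by metis
qed

text \<open>Root label and cotree determine the class by \<open>rep_iso\<close>, and without a mate
  the cotree avoids the pattern. The 2 counts the root labels.\<close>

lemma card_mateless:
  assumes "1 \<le> n"
  shows "card ({E. cograph n E \<and> \<not> has_gen_Q_cospectral_mate n E} // iso_rel n)
    \<le> 2 * card (avoiding claw_tree n)"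
proof -
  let ?M = "{E. cograph n E \<and> \<not> has_gen_Q_cospectral_mate n E}"
  let ?R = "\<lambda>X (b, t). \<exists>E. graph_on n E \<and> rep E b t {0..<n} \<and> X = iso_rel n `` {E}"
  have "card (?M // iso_rel n) \<le> card ((UNIV :: bool set) \<times> avoiding claw_tree n)"
  proof (rule card_le_by_code[where R = ?R])
    show "finite ((UNIV :: bool set) \<times> avoiding claw_tree n)"
      using finite_trees by (simp add: avoiding_def)
  next
    fix X assume "X \<in> ?M // iso_rel n"
    then obtain E where E: "cograph n E" "\<not> has_gen_Q_cospectral_mate n E" "X = iso_rel n `` {E}"
      by (auto elim: quotientE)
    then have g: "graph_on n E" by (simp add: cograph_def)
    obtain b t where t: "rep E b t {0..<n}" "t \<in> trees n"
      using cograph_rep[OF E(1) assms] by blast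
    then have "t \<in> avoiding claw_tree n"
      using mate_of_claw_subtree[OF g t(1)] E(2) by (auto simp: avoiding_def)
    then show "\<exists>c\<in>UNIV \<times> avoiding claw_tree n. ?R X c"
      using g t(1) E(3) by (intro bexI[of _ "(b, t)"]) auto
  next
    fix X Y and c :: "bool \<times> tree"
    obtain b t where c: "c = (b, t)" by (cases c)
    assume "?R X c" "?R Y c"
    then obtain E F where "graph_on n E" "rep E b t {0..<n}" "X = iso_rel n `` {E}"
      "graph_on n F" "rep F b t {0..<n}" "Y = iso_rel n `` {F}" unfolding c by auto
    then show "X = Y" using graph_iso_rep iso_class_eq_iff by metis
  qed
  then show ?thesis by (simp add: card_cartesian_product)
qed

text \<open>The classes of both kinds cover all classes; a class counted on both sides would only
  enlarge the bound.\<close>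

lemma num_cographs_le:
  assumes "1 \<le> n"
  shows "num_cographs n \<le> num_cographs_with_mate n + 2 * card (avoiding claw_tree n)"
proof -
  let ?A = "{E. cograph n E \<and> has_gen_Q_cospectral_mate n E}"
  let ?B = "{E. cograph n E \<and> \<not> has_gen_Q_cospectral_mate n E}"
  have "{E. cograph n E} // iso_rel n = ?A // iso_rel n \<union> ?B // iso_rel n"
    unfolding quotient_def by blast
  then have "num_cographs n \<le> card (?A // iso_rel n) + card (?B // iso_rel n)"
    unfolding num_cographs_def by (simp only: card_Un_le)
  then show ?thesis
    using card_mateless[OF assms] by (simp add: num_cographs_with_mate_def)
qed

lemma num_cographs_with_mate_le: "num_cographs_with_mate n \<le> num_cographs n"
  unfolding num_cographs_with_mate_def num_cographs_def
proof (rule card_mono)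
  show "finite ({E. cograph n E} // iso_rel n)"
    unfolding cograph_def by (rule finite_iso_classes)
  show "{E. cograph n E \<and> has_gen_Q_cospectral_mate n E} // iso_rel n \<subseteq> {E. cograph n E} // iso_rel n"
    unfolding quotient_def by blast
qed

theorem theorem4p4:
  shows "(\<lambda>n. real (num_cographs_with_mate n) / real (num_cographs n)) \<longlonglongrightarrow> 1"
proof (rule tendsto_sandwich)
  let ?a = "\<lambda>n. card (avoiding claw_tree n) / card (trees n)"
  have "(\<lambda>n. 1 - 2 * ?a n) \<longlonglongrightarrow> 1 - 2 * 0"
    by (intro tendsto_intros avoiding_negligible reduced_claw_tree)
  then show "(\<lambda>n. 1 - 2 * ?a n) \<longlonglongrightarrow> 1" by simp
  show "\<forall>\<^sub>F n in sequentially. 1 - 2 * ?a n \<le> num_cographs_with_mate n / num_cographs n"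
  proof (rule eventually_sequentiallyI[of 1])
    fix n :: nat assume n: "1 \<le> n"
    have "0 < card (trees n)"
      using card_trees_ge[OF n] by (rule less_le_trans[rotated]) simp
    moreover note le = card_trees_le_num_cographs[of n]
    ultimately have pos: "0 < real (card (trees n))" "0 < real (num_cographs n)" by linarith+
    \<comment> \<open>There are at least as many cographs as trees, so the avoiding share can be
      measured among trees.\<close>
    have "2 * card (avoiding claw_tree n) / num_cographs n \<le> 2 * card (avoiding claw_tree n) / card (trees n)"
      using pos le by (intro divide_left_mono) auto
    moreover have "real (num_cographs n) \<le> num_cographs_with_mate n + 2 * card (avoiding claw_tree n)"
      using num_cographs_le[OF n] by (simp only: of_nat_le_iff)
    then have "num_cographs n / num_cographs n
        \<le> (real (num_cographs_with_mate n) + 2 * card (avoiding claw_tree n)) / num_cographs n"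
      by (intro divide_right_mono) auto
    then have "1 - 2 * card (avoiding claw_tree n) / num_cographs n
        \<le> num_cographs_with_mate n / num_cographs n"
      using pos by (simp add: add_divide_distrib)
    ultimately show "1 - 2 * ?a n \<le> num_cographs_with_mate n / num_cographs n" by simp
  qed
  show "\<forall>\<^sub>F n in sequentially. num_cographs_with_mate n / num_cographs n \<le> 1"
    using num_cographs_with_mate_le by (intro always_eventually allI divide_le_eq_1[THEN iffD2]) auto
qed (rule tendsto_const)

end
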